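(* Let $p\in[1,+\infty)$, $T>0$, let $(\tau,\mu_\tau)\in[0,T]\times\mathcal{P}_p(\mathbb{R}^d)$ be given, and let $\mu(\cdot)\in\mathrm{AC}([\tau,T],\mathcal{P}_p(\mathbb{R}^d))$ be a solution of $$\partial_t\mu(t)+\mathrm{div}_x(v(t)\mu(t))=0,\qquad\mu(\tau)=\mu_\tau,$$ driven by a Lebesgue-Borel velocity field $v:[0,T]\times\mathbb{R}^d\to\mathbb{R}^d$ for which there exists $m(\cdot)\in L^1([0,T],\mathbb{R}_+)$ such that $|v(t,x)|\le m(t)(1+|x|)$ for $\mathcal{L}^1$-almost every $t$ and $\mu(t)$-almost every $x\in\mathbb{R}^d$. Then the moment bound $$\mathcal{M}_p(\mu(t))\le C_p\bigg(\mathcal{M}_p(\mu_\tau)+\int_\tau^t m(s)\,ds\bigg)\exp\Big(C_p'\|m(\cdot)\|_{L^1([\tau,t])}^p\Big)$$ holds for all times $t\in[\tau,T]$, where $C_p:=2^{(p-1)/p}$ and $C_p':=\tfrac{2^{p-1}}{p}$. In addition, for every $R>0$, the uniform equi-integrability estimate $$\sup_{t\in[\tau,T]}\int_{\{x\,:\,|x|\ge R\}}|x|^p\,d\mu(t)(x)\le C_T^p\int_{\{x\,:\,|x|\ge R/C_T-1\}}\big(1+|x|\big)^p\,d\mu_\tau(x)$$ holds with $C_T:=\max\{1,\|m(\cdot)\|_{L^1([0,T])}\}\exp\big(\|m(\cdot)\|_{L^1([0,T])}\big)$.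
   Context: $\mathcal{P}_p(\mathbb{R}^d)$ is the set of Borel probability measures on $\mathbb{R}^d$ with finite $p$-th moment, endowed with the Wasserstein distance $W_p$; $\mathcal{M}_p(\mu):=\big(\int_{\mathbb{R}^d}|x|^p\,d\mu(x)\big)^{1/p}$. $\mathrm{AC}([\tau,T],\mathcal{P}_p(\mathbb{R}^d))$ is the set of curves that are absolutely continuous with respect to $W_p$. $\mathcal{L}^1$ is the one-dimensional Lebesgue measure. A Lebesgue-Borel field is one measurable for the product of the Lebesgue $\sigma$-algebra in $t$ and the Borel $\sigma$-algebra in $x$. The continuity equation is understood in the sense of distributions: $\int_\tau^T\int_{\mathbb{R}^d}\big(\partial_t\phi(t,x)+\langle\nabla_x\phi(t,x),v(t,x)\rangle\big)\,d\mu(t)(x)\,dt=0$ for every $\phi\in C^\infty_c((\tau,T)\times\mathbb{R}^d,\mathbb{R})$. *)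

theory Defs
  imports "HOL-Probability.Probability"
begin

definition prob_measures :: "real \<Rightarrow> 'a::euclidean_space measure set" where
  "prob_measures p =
     {\<mu>. prob_space \<mu> \<and> sets \<mu> = sets borel \<and> integrable \<mu> (\<lambda>x. norm x powr p)}"

definition moment :: "real \<Rightarrow> 'a::euclidean_space measure \<Rightarrow> real" where
  "moment p \<mu> = (\<integral>x. norm x powr p \<partial>\<mu>) powr (1 / p)"

definition couplings ::
    "'a::euclidean_space measure \<Rightarrow> 'a measure \<Rightarrow> ('a \<times> 'a) measure set" where
  "couplings \<mu> \<nu> =
     {\<gamma>. sets \<gamma> = sets borel \<and> distr \<gamma> borel fst = \<mu> \<and> distr \<gamma> borel snd = \<nu>}"

text \<open>The infimum is finite whenever both measures belong to \<^term>\<open>prob_measures p\<close>,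
  so that nothing is lost in passing from extended to ordinary reals.\<close>

definition wasserstein :: "real \<Rightarrow> 'a::euclidean_space measure \<Rightarrow> 'a measure \<Rightarrow> real" where
  "wasserstein p \<mu> \<nu> =
     enn2real (INF \<gamma>\<in>couplings \<mu> \<nu>. \<integral>\<^sup>+z. ennreal (norm (fst z - snd z) powr p) \<partial>\<gamma>) powr (1 / p)"

text \<open>Absolute continuity of a curve in a metric space, in the sense of Ambrosio, Gigli and
  Savare: the distance between two points of the curve is bounded by the integral of a fixed
  integrable function over the corresponding time interval.\<close>

definition wasserstein_AC ::
    "real \<Rightarrow> real \<Rightarrow> real \<Rightarrow> (real \<Rightarrow> 'a::euclidean_space measure) \<Rightarrow> bool" where
  "wasserstein_AC p a b \<mu> \<longleftrightarrow>
     (\<forall>t\<in>{a..b}. \<mu> t \<in> prob_measures p) \<and>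
     (\<exists>g. set_integrable lebesgue {a..b} g \<and> (\<forall>t\<in>{a..b}. 0 \<le> g t) \<and>
        (\<forall>s\<in>{a..b}. \<forall>t\<in>{s..b}.
           wasserstein p (\<mu> s) (\<mu> t) \<le> (LINT r:{s..t}|lebesgue. g r)))"

primrec C_k :: "nat \<Rightarrow> ('a::euclidean_space \<Rightarrow> real) \<Rightarrow> bool" where
  "C_k 0 f \<longleftrightarrow> continuous_on UNIV f"
| "C_k (Suc k) f \<longleftrightarrow>
     (\<forall>z. f differentiable (at z)) \<and> (\<forall>h. C_k k (\<lambda>z. frechet_derivative f (at z) h))"

text \<open>Smooth functions with compact support in an open set \<open>U\<close>, identified with their
  extensions by zero to the whole space.\<close>

definition test_functions :: "'a::euclidean_space set \<Rightarrow> ('a \<Rightarrow> real) set" where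
  "test_functions U =
     {\<phi>. (\<forall>k. C_k k \<phi>) \<and> compact (closure {z. \<phi> z \<noteq> 0}) \<and> closure {z. \<phi> z \<noteq> 0} \<subseteq> U}"

definition gradient :: "('a::euclidean_space \<Rightarrow> real) \<Rightarrow> 'a \<Rightarrow> 'a" where
  "gradient f x = (\<Sum>b\<in>Basis. frechet_derivative f (at x) b *\<^sub>R b)"

text \<open>The time integral has to be taken with respect to \<^term>\<open>lebesgue\<close> and not
  \<^term>\<open>lborel\<close>, because \<open>v\<close> is only Lebesgue measurable in time. For narrowly
  continuous curves and Lebesgue-Borel fields with \<open>|v(t,x)| \<le> m(t) (1 + |x|)\<close>,
  \<open>m\<close> integrable, both integrals below converge absolutely.\<close>

definition continuity_equation ::
    "real \<Rightarrow> real \<Rightarrow> (real \<Rightarrow> 'a::euclidean_space \<Rightarrow> 'a) \<Rightarrow> (real \<Rightarrow> 'a measure) \<Rightarrow> bool" where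
  "continuity_equation a b v \<mu> \<longleftrightarrow>
     (\<forall>\<phi>\<in>test_functions ({a<..<b} \<times> UNIV).
        (LINT t:{a..b}|lebesgue.
           (\<integral>x. deriv (\<lambda>s. \<phi> (s, x)) t + gradient (\<lambda>y. \<phi> (t, y)) x \<bullet> v t x \<partial>\<mu> t)) = 0)"

definition L1_norm :: "real \<Rightarrow> real \<Rightarrow> (real \<Rightarrow> real) \<Rightarrow> real" where
  "L1_norm a b m = (LINT s:{a..b}|lebesgue. \<bar>m s\<bar>)"

end

theory Submission
  imports Defs
begin

text \<open>
  Since \<open>|v| \<le> m (1 + |x|)\<close>, mass cannot move outwards faster than along the solutions
  \<open>\<sigma>(t) = e\<^bsup>A(t)\<^esup> (1 + \<rho>) - 1\<close>, where \<open>A(t)\<close> is the integral of \<open>m\<close> over \<open>[\<tau>, t]\<close>, of the radial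
  equation \<open>\<sigma>' = m (1 + \<sigma>)\<close>. Testing the continuity equation with smooth radial cut-offs of the
  ball of radius \<open>\<sigma>(t)\<close> shows
  \<open>\<mu>(t) {|x| \<ge> \<sigma>(t)} \<le> \<mu>(\<tau>) {|x| \<ge> \<rho>}\<close> for every \<open>\<rho> \<ge> 0\<close>, without the superposition principle.
  As \<open>A\<close> is only absolutely continuous, the threshold is moved at discrete times: over \<open>[s, t]\<close> the
  increment is bounded by the square of the increment of a continuous monotone function, so the
  errors vanish as the partition is refined. In terms of random variables, \<open>|x|\<close> under \<open>\<mu>(t)\<close> is
  stochastically dominated by \<open>e\<^bsup>A(t)\<^esup> (1 + |x|) - 1\<close> under \<open>\<mu>(\<tau>)\<close>. Integrating monotone functions
  gives the tail estimate, and with Minkowski's inequality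
  \<open>M\<^sub>p(\<mu>(t)) \<le> e\<^bsup>A(t)\<^esup> (M\<^sub>p(\<mu>(\<tau>)) + A(t))\<close>; the stated constants follow from
  \<open>L \<le> (p-1)/p ln 2 + 2\<^bsup>p-1\<^esup> L\<^sup>p / p\<close>.
\<close>

section \<open>Smooth step functions\<close>

text \<open>The first-order cancellation happens while the width \<delta> of the radial step is
  still fixed. The flux through the layer is at most
  \<open>2 * \<sigma> * (1 + \<sigma>) / \<delta> * m\<close> times the mean of \<open>S'\<close>,
  and moving the threshold lowers the mean of \<open>S\<close> by a multiple of that same mean.
  Replacing the mean of \<open>S'\<close> by a constant would leave a term of order 1/\<delta>. For
  gain and loss to refer to one number, the mean of \<open>S'\<close> must be nearly constant over a
  short time interval. This is where absolute continuity in W_p enters: by the easy half of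
  Kantorovich duality, integrals of bounded Lipschitz functions change by at most a constant times
  the increment of a fixed continuous monotone function. Such an increment multiplied by an
  increment of \<open>A\<close> is the quadratic error. The same bound makes the curve a measurable
  kernel and removes the smoothing in time. The step is applied to |x|^2 and not to |x|, so that the
  cut-off is smooth at the origin.\<close>

definition flat_exp :: "real poly \<Rightarrow> real \<Rightarrow> real" where
  "flat_exp P x = (if x \<le> 0 then 0 else poly P (1 / x) * exp (- (1 / x)))"

text \<open>The factor \<open>[:0, 0, 1:]\<close> is X^2: both the polynomial and the exponential
  are functions of 1/x, whose derivative is -1/x^2.\<close>

definition flat_exp_deriv :: "real poly \<Rightarrow> real poly" where
  "flat_exp_deriv P = [:0, 0, 1:] * (P - pderiv P)"

lemma poly_exp_tendsto_0:
  fixes P :: "real poly"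
  shows "((\<lambda>x. poly P x * exp (- x)) \<longlongrightarrow> 0) at_top"
proof -
  have "((\<lambda>x. \<Sum>i\<le>degree P. coeff P i * (x ^ i / exp x)) \<longlongrightarrow> (\<Sum>i\<le>degree P. coeff P i * 0)) at_top"
    by (intro tendsto_intros tendsto_power_div_exp_0)
  then show ?thesis
    by (simp add: poly_altdef exp_minus field_simps sum_divide_distrib)
qed

text \<open>Differentiation only replaces the polynomial, so the family \<open>flat_exp P\<close> is
  closed under derivatives, and smoothness of exp(-1/x) extended by 0 becomes one induction over all
  \<open>P\<close>.\<close>

lemma flat_exp_has_derivative:
  "(flat_exp P has_field_derivative flat_exp (flat_exp_deriv P) x) (at x)"
proof (cases x "0::real" rule: linorder_cases)
  case less
  have "((\<lambda>_. 0) has_field_derivative 0) (at x)" by simp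
  moreover have "eventually (\<lambda>y. flat_exp P y = 0) (nhds x)"
    using eventually_nhds_in_open[of "{..<0}" x] less by (auto simp: flat_exp_def elim: eventually_mono)
  ultimately show ?thesis
    using DERIV_cong_ev[of x x "flat_exp P" "\<lambda>_. 0" 0 0] less by (auto simp: flat_exp_def)
next
  case greater
  have "((\<lambda>y. poly P (1 / y) * exp (- (1 / y))) has_field_derivative
     (poly (pderiv P) (1/x) * (- 1 / x\<^sup>2)) * exp (- (1/x)) + exp (- (1/x)) * (1 / x\<^sup>2) * poly P (1/x)) (at x)"
    using greater
    by (auto intro!: derivative_eq_intros DERIV_chain2[OF poly_DERIV] simp: power2_eq_square field_simps)
  moreover have "eventually (\<lambda>y. flat_exp P y = poly P (1 / y) * exp (- (1 / y))) (nhds x)"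
    using eventually_nhds_in_open[of "{0<..}" x] greater by (auto simp: flat_exp_def elim: eventually_mono)
  moreover have "flat_exp (flat_exp_deriv P) x = (poly (pderiv P) (1/x) * (- 1 / x\<^sup>2)) * exp (- (1/x)) + exp (- (1/x)) * (1 / x\<^sup>2) * poly P (1/x)"
    using greater by (simp add: flat_exp_def flat_exp_deriv_def power2_eq_square field_simps)
  ultimately show ?thesis
    using DERIV_cong_ev[of x x "flat_exp P" "\<lambda>y. poly P (1 / y) * exp (- (1 / y))"] by auto
next
  case equal
  have "((\<lambda>h. flat_exp P h / h) \<longlongrightarrow> 0) (at_right 0)"
  proof -
    \<comment> \<open>Dividing by h multiplies the polynomial by X, hence \<open>pCons 0 P\<close>;
      the exponential still wins.\<close>
    have "((\<lambda>h. poly (pCons 0 P) (inverse h) * exp (- inverse h)) \<longlongrightarrow> 0) (at_right (0::real))"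
      by (rule filterlim_compose[OF poly_exp_tendsto_0 filterlim_inverse_at_top_right])
    then show ?thesis
      by (rule Lim_transform_eventually)
         (auto simp: flat_exp_def field_simps intro!: eventually_mono[OF eventually_at_right_less])
  qed
  moreover have "((\<lambda>h. flat_exp P h / h) \<longlongrightarrow> 0) (at_left 0)"
    by (rule Lim_transform_eventually[OF tendsto_const])
       (auto simp: flat_exp_def eventually_at_left intro!: exI[of _ "-1"] eventually_mono[OF eventually_at_left_real[of "-1" 0]])
  ultimately have "((\<lambda>h. flat_exp P h / h) \<longlongrightarrow> 0) (at 0)"
    by (simp add: filterlim_split_at)
  then show ?thesis
    using equal by (simp add: DERIV_def flat_exp_def)
qed

section \<open>Calculus for the classes \<open>C_k\<close>\<close>

abbreviation smooth :: "('a::euclidean_space \<Rightarrow> real) \<Rightarrow> bool" where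
  "smooth f \<equiv> \<forall>k. C_k k f"

lemma C_k_SucI:
  assumes "\<And>z. (f has_derivative f' z) (at z)" and "\<And>h. C_k k (\<lambda>z. f' z h)"
  shows "C_k (Suc k) f"
proof -
  have "frechet_derivative f (at z) = f' z" for z
    using frechet_derivative_at[OF assms(1)] by simp
  then show ?thesis
    using assms by (auto simp: differentiable_def)
qed

lemma C_k_SucD:
  assumes "C_k (Suc k) f"
  shows "(f has_derivative frechet_derivative f (at z)) (at z)"
    and "C_k k (\<lambda>z. frechet_derivative f (at z) h)"
  using assms by (auto simp: frechet_derivative_works)

lemma C_k_decSuc: "C_k (Suc k) f \<Longrightarrow> C_k k f"
proof (induction k arbitrary: f)
  case 0
  then show ?case
    by (auto intro!: continuous_at_imp_continuous_on differentiable_imp_continuous_within)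
next
  case (Suc k)
  then show ?case by (metis C_k.simps(2))
qed

lemma C_k_const: "C_k k (\<lambda>_. c)"
  by (induction k arbitrary: c) (auto intro!: C_k_SucI[where f' = "\<lambda>_ _. 0"] simp del: C_k.simps(2))

lemma C_k_add: "C_k k f \<Longrightarrow> C_k k g \<Longrightarrow> C_k k (\<lambda>z. f z + g z)"
proof (induction k arbitrary: f g)
  case 0
  then show ?case by (auto intro: continuous_on_add)
next
  case (Suc k)
  show ?case
    by (rule C_k_SucI, rule has_derivative_add[OF C_k_SucD(1)[OF Suc.prems(1)] C_k_SucD(1)[OF Suc.prems(2)]])
       (intro Suc.IH C_k_SucD(2) Suc.prems)
qed

lemma C_k_sum: "(\<And>i. i \<in> I \<Longrightarrow> C_k k (f i)) \<Longrightarrow> C_k k (\<lambda>z. \<Sum>i\<in>I. f i z)"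
  by (induction I rule: infinite_finite_induct) (auto intro!: C_k_add C_k_const)

lemma C_k_mult: "C_k k f \<Longrightarrow> C_k k g \<Longrightarrow> C_k k (\<lambda>z. f z * g z)"
proof (induction k arbitrary: f g)
  case 0
  then show ?case by (auto intro: continuous_on_mult)
next
  case (Suc k)
  show ?case
    by (rule C_k_SucI, rule has_derivative_mult[OF C_k_SucD(1)[OF Suc.prems(1)] C_k_SucD(1)[OF Suc.prems(2)]])
       (intro C_k_add Suc.IH C_k_SucD(2) C_k_decSuc[OF Suc.prems(1)] C_k_decSuc[OF Suc.prems(2)] Suc.prems)
qed

lemma C_k_bounded_linear: "bounded_linear f \<Longrightarrow> C_k k f"
proof (cases k)
  case 0
  assume "bounded_linear f"
  with 0 show ?thesis by (simp add: linear_continuous_on)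
next
  case (Suc j)
  assume "bounded_linear f"
  with Suc show ?thesis
    by (auto intro!: C_k_SucI[where f' = "\<lambda>_. f"] C_k_const bounded_linear_imp_has_derivative simp del: C_k.simps(2))
qed

text \<open>With a scalar outer function the chain rule yields a product, the derivative of
  \<open>f\<close> at \<open>q z\<close> times a directional derivative of \<open>q\<close>, so the
  induction step reduces to \<open>C_k_mult\<close>. The derivative of \<open>f\<close> takes the
  place of \<open>f\<close>, hence the induction over arbitrary \<open>f\<close>.\<close>

lemma C_k_compose: "C_k k f \<Longrightarrow> C_k k q \<Longrightarrow> C_k k (\<lambda>z. f (q z))" for f :: "real \<Rightarrow> real"
proof (induction k arbitrary: f q)
  case 0
  then show ?case
    using continuous_on_compose2[of UNIV f UNIV q] by auto
next
  case (Suc k)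
  have lin: "linear (frechet_derivative f (at x))" for x
    using C_k_SucD(1)[OF Suc.prems(1)] by (rule has_derivative_linear)
  have "((\<lambda>z. f (q z)) has_derivative
      (\<lambda>h. frechet_derivative f (at (q z)) 1 * frechet_derivative q (at z) h)) (at z)" for z
  proof -
    have "frechet_derivative f (at (q z)) r = frechet_derivative f (at (q z)) 1 * r" for r
      using linear_scale[OF lin[of "q z"], of r 1] by (simp add: mult.commute)
    then have "(\<lambda>h. frechet_derivative f (at (q z)) (frechet_derivative q (at z) h)) =
        (\<lambda>h. frechet_derivative f (at (q z)) 1 * frechet_derivative q (at z) h)"
      by (intro ext)
    then show ?thesis
      using has_derivative_compose[OF C_k_SucD(1)[OF Suc.prems(2), of z] C_k_SucD(1)[OF Suc.prems(1), of "q z"]]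
      by (simp add: o_def)
  qed
  then show ?case
    by (rule C_k_SucI)
       (intro C_k_mult Suc.IH[of "\<lambda>x. frechet_derivative f (at x) 1" q] C_k_SucD(2) Suc.prems C_k_decSuc[OF Suc.prems(2)])
qed

lemma C_k_Suc_real:
  assumes "\<And>x. (f has_field_derivative f' x) (at x)" and "C_k k f'"
  shows "C_k (Suc k) f"
  by (rule C_k_SucI[where f' = "\<lambda>x h. f' x * h"])
     (use assms in \<open>auto simp: has_field_derivative_def intro!: C_k_mult C_k_const\<close>)

lemma smooth_flat_exp: "C_k k (flat_exp P)"
proof (induction k arbitrary: P)
  case 0
  show ?case
    using DERIV_isCont[OF flat_exp_has_derivative] by (auto intro!: continuous_at_imp_continuous_on)
next
  case (Suc k)
  show ?case by (rule C_k_Suc_real[OF flat_exp_has_derivative Suc])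
qed

lemma smooth_real_deriv:
  fixes f :: "real \<Rightarrow> real"
  assumes "smooth f"
  shows "(f has_field_derivative deriv f x) (at x)" and "smooth (deriv f)"
proof -
  have D: "(f has_derivative frechet_derivative f (at z)) (at z)" for z
    using C_k_SucD(1)[of 0 f] assms by blast
  have F: "(f has_field_derivative frechet_derivative f (at z) 1) (at z)" for z
  proof -
    have "frechet_derivative f (at z) = (*) (frechet_derivative f (at z) 1)"
    proof
      fix r
      show "frechet_derivative f (at z) r = frechet_derivative f (at z) 1 * r"
        using linear_scale[OF has_derivative_linear[OF D[of z]], of r 1]
        by (metis mult.commute mult.right_neutral real_scaleR_def)
    qed
    then show ?thesis using D[of z] by (simp add: has_field_derivative_def)
  qed
  have eq: "deriv f z = frechet_derivative f (at z) 1" for z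
    using F by (rule DERIV_imp_deriv)
  show "(f has_field_derivative deriv f x) (at x)" using F eq by simp
  show "smooth (deriv f)"
  proof
    fix k
    have "C_k k (\<lambda>z. frechet_derivative f (at z) 1)"
      using assms C_k_SucD(2) by blast
    then show "C_k k (deriv f)" by (simp add: eq[abs_def])
  qed
qed

text \<open>The step is the normalised primitive of the bump \<open>w\<close>, which is positive
  exactly on (0, 1). Its derivative is a multiple of \<open>w\<close>, so smoothness and
  monotonicity are inherited from \<open>w\<close>.\<close>

lemma exists_smooth_step:
  obtains S :: "real \<Rightarrow> real" where
    "smooth S" "\<And>x. x \<le> 0 \<Longrightarrow> S x = 0" "\<And>x. 1 \<le> x \<Longrightarrow> S x = 1" "\<And>x. 0 \<le> deriv S x"
proof -
  define e where "e = flat_exp 1"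
  define w where "w x = e x * e (1 - x)" for x
  have "C_k k (\<lambda>x. e (1 + (- x)))" for k
    unfolding e_def
    by (rule C_k_compose[of k "flat_exp 1" "\<lambda>x. 1 + - x"])
       (intro smooth_flat_exp C_k_add C_k_const C_k_bounded_linear bounded_linear_minus bounded_linear_ident)+
  then have w: "C_k k w" for k
    unfolding w_def[abs_def] by (intro C_k_mult) (simp_all add: e_def smooth_flat_exp)
  have w_nonneg: "0 \<le> w x" for x by (simp add: w_def e_def flat_exp_def)
  have w_pos: "0 < w x" if "0 < x" "x < 1" for x using that by (simp add: w_def e_def flat_exp_def)
  have w_zero: "w x = 0" if "x \<le> 0 \<or> 1 \<le> x" for x using that by (auto simp: w_def e_def flat_exp_def)
  have "continuous_on UNIV w" using w[of 0] by simp
  then have "isCont w x" for x by (simp add: continuous_on_eq_continuous_at)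
  with einterval_antiderivative[of "-\<infinity>" \<infinity> w] obtain F where
    F: "(F has_field_derivative w x) (at x)" for x
    by (auto simp: has_real_derivative_iff_has_vector_derivative)
  have F_cont: "continuous_on A F" for A
    using F by (auto intro!: DERIV_isCont continuous_at_imp_continuous_on)
  have F_flat: "(F has_field_derivative 0) (at y)" if "y \<le> 0 \<or> 1 \<le> y" for y
    using F[of y] w_zero[OF that] by simp
  have F0: "F x = F 0" if "x \<le> 0" for x
  proof (cases "x = 0")
    case False
    then have "F 0 = F x"
      using that by (intro DERIV_isconst_end[OF _ F_cont] F_flat) auto
    then show ?thesis by simp
  qed simp
  have F1: "F x = F 1" if "1 \<le> x" for x
  proof (cases "x = 1")
    case False
    then show ?thesis
      using that by (intro DERIV_isconst_end[OF _ F_cont] F_flat) auto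
  qed simp
  have "F 0 < F 1"
    using F w_pos
    by (intro DERIV_pos_imp_increasing_open[of 0 1 F]) (auto intro!: F_cont)
  define S where "S x = (F x - F 0) / (F 1 - F 0)" for x
  have DS: "(S has_field_derivative (1 / (F 1 - F 0)) * w x) (at x)" for x
    unfolding S_def[abs_def] using \<open>F 0 < F 1\<close> by (auto intro!: derivative_eq_intros F)
  have CS: "C_k (Suc k) S" for k
    by (rule C_k_Suc_real[OF DS]) (intro C_k_mult C_k_const w)
  have 1: "smooth S" by (rule allI, rule C_k_decSuc, rule CS)
  have "deriv S x = (1 / (F 1 - F 0)) * w x" for x
    using DS by (rule DERIV_imp_deriv)
  then have 2: "0 \<le> deriv S x" for x
    using \<open>F 0 < F 1\<close> w_nonneg[of x] by simp
  have 3: "S x = 0" if "x \<le> 0" for x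
    unfolding S_def F0[OF that] by simp
  have 4: "S x = 1" if "1 \<le> x" for x
    unfolding S_def F1[OF that] using \<open>F 0 < F 1\<close> by simp
  show thesis
    by (rule that[OF 1 3 4 2])
qed

section \<open>Wasserstein distance and Lipschitz functions\<close>

text \<open>Convexity of the power, in the one form used throughout: for Jensen's and Minkowski's
  inequalities and for the comparison of L with L^p. At y = 0 the tangent has the value (1 - p) D^p,
  which is not positive.\<close>

lemma powr_above_tangent:
  fixes D y p :: real
  assumes "1 \<le> p" "0 < D" "0 \<le> y"
  shows "D powr p + p * D powr (p - 1) * (y - D) \<le> y powr p"
proof (cases "y = 0")
  case True
  have "D powr (p - 1) * D = D powr p"
    using assms powr_add[of D "p - 1" 1] by simp
  then have "D powr p + p * D powr (p - 1) * (y - D) = (1 - p) * D powr p"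
    using True by (simp add: algebra_simps)
  then show ?thesis
    using assms True by (simp add: mult_nonpos_nonneg)
next
  case False
  have "y powr p - D powr p \<ge> (p * D powr (p - 1)) * (y - D)"
  proof (rule convex_on_imp_above_tangent[where A = "{0<..}"])
    show "convex_on {0<..} (\<lambda>x. x powr p)"
      using powr_convex[OF assms(1)] by (rule convex_on_subset) auto
    show "((\<lambda>x. x powr p) has_real_derivative p * D powr (p - 1)) (at D within {0<..})"
      using assms by (auto intro!: derivative_eq_intros)
  qed (use assms False in \<open>auto simp: interior_open\<close>)
  then show ?thesis by simp
qed

text \<open>The tangent inequality at \<open>D\<close> is integrated after all subtractions have
  been moved to the other side, so it lives in the extended nonnegative reals and \<open>f\<close>
  need not be integrable. As the slope is nonnegative, a lower bound \<open>D\<close> of the mean is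
  enough.\<close>

lemma (in prob_space) nn_integral_powr_jensen:
  fixes f :: "'a \<Rightarrow> real" and p D :: real
  assumes [measurable]: "f \<in> borel_measurable M" and "\<And>x. 0 \<le> f x" "1 \<le> p" "0 \<le> D"
    and le: "ennreal D \<le> (\<integral>\<^sup>+x. ennreal (f x) \<partial>M)"
  shows "ennreal (D powr p) \<le> (\<integral>\<^sup>+x. ennreal (f x powr p) \<partial>M)"
proof (cases "D = 0")
  case False
  with assms have "0 < D" by simp
  define c where "c = p * D powr (p - 1)"
  have "0 \<le> c" using assms by (simp add: c_def)
  have pt: "ennreal (c * f x + D powr p) \<le> ennreal (f x powr p) + ennreal (c * D)" for x
    using powr_above_tangent[OF \<open>1 \<le> p\<close> \<open>0 < D\<close> assms(2)[of x]] \<open>0 \<le> c\<close> \<open>0 \<le> D\<close>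
    by (subst ennreal_plus[symmetric]) (auto simp del: ennreal_plus simp: c_def algebra_simps)
  have "ennreal (c * D) + ennreal (D powr p) \<le> ennreal c * (\<integral>\<^sup>+x. ennreal (f x) \<partial>M) + ennreal (D powr p)"
    using le \<open>0 \<le> c\<close> assms(4) by (auto simp: ennreal_mult intro!: add_right_mono mult_left_mono)
  also have "\<dots> = (\<integral>\<^sup>+x. ennreal (c * f x + D powr p) \<partial>M)"
    using assms(2) \<open>0 \<le> c\<close>
    by (simp add: ennreal_plus ennreal_mult nn_integral_add nn_integral_cmult emeasure_space_1)
  also have "\<dots> \<le> (\<integral>\<^sup>+x. ennreal (f x powr p) + ennreal (c * D) \<partial>M)"
    by (intro nn_integral_mono pt)
  also have "\<dots> = (\<integral>\<^sup>+x. ennreal (f x powr p) \<partial>M) + ennreal (c * D)"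
    by (simp add: nn_integral_add emeasure_space_1)
  finally show ?thesis
    by (metis add.commute ennreal_add_left_cancel_le ennreal_neq_top infinity_ennreal_def)
qed simp

lemma powr_add_le:
  fixes a b p :: real
  assumes "0 \<le> a" "0 \<le> b" "0 \<le> p"
  shows "(a + b) powr p \<le> 2 powr p * (a powr p + b powr p)"
proof -
  have "(a + b) powr p \<le> (2 * max a b) powr p"
    using assms by (intro powr_mono2) auto
  also have "\<dots> = 2 powr p * max a b powr p"
    using assms by (simp add: powr_mult)
  also have "\<dots> \<le> 2 powr p * (a powr p + b powr p)"
    by (intro mult_left_mono) (auto simp: max_def)
  finally show ?thesis .
qed

text \<open>Ensures that the infimum in \<open>wasserstein\<close> is finite, so that
  \<open>enn2real\<close> does not collapse it to 0.\<close>

lemma product_coupling_finite_cost: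
  fixes \<mu> \<nu> :: "'a::euclidean_space measure"
  assumes "0 \<le> p" "\<mu> \<in> prob_measures p" "\<nu> \<in> prob_measures p"
  shows "\<mu> \<Otimes>\<^sub>M \<nu> \<in> couplings \<mu> \<nu>"
    and "(\<integral>\<^sup>+z. ennreal (norm (fst z - snd z) powr p) \<partial>(\<mu> \<Otimes>\<^sub>M \<nu>)) < \<infinity>"
proof -
  interpret \<mu>: prob_space \<mu> using assms by (simp add: prob_measures_def)
  interpret \<nu>: prob_space \<nu> using assms by (simp add: prob_measures_def)
  interpret pair_prob_space \<mu> \<nu> ..
  have sets[measurable_cong]: "sets \<mu> = sets borel" "sets \<nu> = sets borel"
    using assms by (auto simp: prob_measures_def)
  have "sets (\<mu> \<Otimes>\<^sub>M \<nu>) = sets borel"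
    using sets_pair_measure_cong[OF sets] by (simp add: borel_prod[symmetric])
  moreover have fst: "distr (\<mu> \<Otimes>\<^sub>M \<nu>) borel fst = \<mu>"
    using \<nu>.distr_pair_fst[of \<mu>] distr_cong[OF refl sets(1), of "\<mu> \<Otimes>\<^sub>M \<nu>" fst fst] by simp
  moreover have snd: "distr (\<mu> \<Otimes>\<^sub>M \<nu>) borel snd = \<nu>"
  proof (rule measure_eqI)
    fix A assume "A \<in> sets (distr (\<mu> \<Otimes>\<^sub>M \<nu>) borel snd)"
    then have A: "A \<in> sets borel" by simp
    have "emeasure (distr (\<mu> \<Otimes>\<^sub>M \<nu>) borel snd) A = emeasure (\<mu> \<Otimes>\<^sub>M \<nu>) (space \<mu> \<times> A)"
      using A sets_eq_imp_space_eq[OF sets(2)]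
      by (subst emeasure_distr) (auto intro!: arg_cong2[where f = emeasure] simp: space_pair_measure)
    then show "emeasure (distr (\<mu> \<Otimes>\<^sub>M \<nu>) borel snd) A = emeasure \<nu> A"
      using A \<nu>.emeasure_pair_measure_Times[OF sets.top[of \<mu>], of A]
      by (simp add: sets \<mu>.emeasure_space_1)
  qed (simp add: sets)
  ultimately show "\<mu> \<Otimes>\<^sub>M \<nu> \<in> couplings \<mu> \<nu>"
    by (simp add: couplings_def)
  have int: "integrable \<mu> (\<lambda>x. norm x powr p)" "integrable \<nu> (\<lambda>x. norm x powr p)"
    using assms by (auto simp: prob_measures_def)
  have fin: "(\<integral>\<^sup>+x. ennreal (norm x powr p) \<partial>\<mu>) < \<infinity>" "(\<integral>\<^sup>+x. ennreal (norm x powr p) \<partial>\<nu>) < \<infinity>"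
    using int by (simp_all add: nn_integral_eq_integral)
  have "(\<integral>\<^sup>+z. ennreal (norm (fst z - snd z) powr p) \<partial>(\<mu> \<Otimes>\<^sub>M \<nu>))
      \<le> (\<integral>\<^sup>+z. ennreal (2 powr p) * (ennreal (norm (fst z) powr p) + ennreal (norm (snd z) powr p)) \<partial>(\<mu> \<Otimes>\<^sub>M \<nu>))"
  proof (intro nn_integral_mono)
    fix z :: "'a \<times> 'a"
    have "norm (fst z - snd z) powr p \<le> (norm (fst z) + norm (snd z)) powr p"
      using assms by (intro powr_mono2 norm_triangle_ineq4) auto
    also have "\<dots> \<le> 2 powr p * (norm (fst z) powr p + norm (snd z) powr p)"
      using assms by (intro powr_add_le) auto
    finally show "ennreal (norm (fst z - snd z) powr p)
        \<le> ennreal (2 powr p) * (ennreal (norm (fst z) powr p) + ennreal (norm (snd z) powr p))"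
      by (simp add: ennreal_mult[symmetric] flip: ennreal_plus)
  qed
  also have "\<dots> = ennreal (2 powr p) * ((\<integral>\<^sup>+z. ennreal (norm (fst z) powr p) \<partial>(\<mu> \<Otimes>\<^sub>M \<nu>))
      + (\<integral>\<^sup>+z. ennreal (norm (snd z) powr p) \<partial>(\<mu> \<Otimes>\<^sub>M \<nu>)))"
    by (simp add: nn_integral_cmult nn_integral_add)
  also have "(\<integral>\<^sup>+z. ennreal (norm (fst z) powr p) \<partial>(\<mu> \<Otimes>\<^sub>M \<nu>)) = (\<integral>\<^sup>+x. ennreal (norm x powr p) \<partial>\<mu>)"
    by (subst (2) fst[symmetric], subst nn_integral_distr) simp_all
  also have "(\<integral>\<^sup>+z. ennreal (norm (snd z) powr p) \<partial>(\<mu> \<Otimes>\<^sub>M \<nu>)) = (\<integral>\<^sup>+x. ennreal (norm x powr p) \<partial>\<nu>)"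
    by (subst (2) snd[symmetric], subst nn_integral_distr) simp_all
  also have "ennreal (2 powr p) * ((\<integral>\<^sup>+x. ennreal (norm x powr p) \<partial>\<mu>) + (\<integral>\<^sup>+x. ennreal (norm x powr p) \<partial>\<nu>)) < \<infinity>"
    using fin by (simp add: ennreal_mult_less_top)
  finally show "(\<integral>\<^sup>+z. ennreal (norm (fst z - snd z) powr p) \<partial>(\<mu> \<Otimes>\<^sub>M \<nu>)) < \<infinity>" .
qed

text \<open>The easy half of Kantorovich duality: along any coupling the difference of the integrals
  is at most L times the mean of |x - y|, and Jensen passes from the exponent 1 to p. Boundedness of
  \<psi> gives integrability.\<close>

lemma lipschitz_integral_diff_le_wasserstein:
  fixes \<psi> :: "'a::euclidean_space \<Rightarrow> real"
  assumes p: "1 \<le> p" and \<mu>: "\<mu> \<in> prob_measures p" and \<nu>: "\<nu> \<in> prob_measures p"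
    and lip: "L-lipschitz_on UNIV \<psi>" and bd: "\<And>x. \<bar>\<psi> x\<bar> \<le> B"
  shows "\<bar>(\<integral>x. \<psi> x \<partial>\<mu>) - (\<integral>x. \<psi> x \<partial>\<nu>)\<bar> \<le> L * wasserstein p \<mu> \<nu>"
proof -
  have "0 \<le> L" using lip by (rule lipschitz_on_nonneg)
  have [measurable]: "\<psi> \<in> borel_measurable borel"
    using lipschitz_on_continuous_on[OF lip] by (rule borel_measurable_continuous_onI)
  define \<Delta> where "\<Delta> = \<bar>(\<integral>x. \<psi> x \<partial>\<mu>) - (\<integral>x. \<psi> x \<partial>\<nu>)\<bar>"
  have key: "ennreal (\<Delta> powr p) \<le> ennreal (L powr p) * (\<integral>\<^sup>+z. ennreal (norm (fst z - snd z) powr p) \<partial>\<gamma>)"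
    if "\<gamma> \<in> couplings \<mu> \<nu>" for \<gamma>
  proof -
    have sets[measurable_cong]: "sets \<gamma> = sets borel" and fst: "distr \<gamma> borel fst = \<mu>"
      and snd: "distr \<gamma> borel snd = \<nu>"
      using that by (auto simp: couplings_def)
    have [measurable]: "fst \<in> borel_measurable \<gamma>" "snd \<in> borel_measurable \<gamma>"
      by (simp_all add: measurable_cong_sets[OF sets refl] borel_measurable_continuous_onI
          continuous_on_fst continuous_on_snd continuous_on_id)
    interpret \<mu>: prob_space "distr \<gamma> borel fst" using \<mu> fst by (simp add: prob_measures_def)
    interpret \<gamma>: prob_space \<gamma>
      by (rule prob_space_distrD[of fst _ borel]) (auto intro: \<mu>.prob_space_axioms)
    have int: "integrable \<gamma> (\<lambda>z. \<psi> (fst z))" "integrable \<gamma> (\<lambda>z. \<psi> (snd z))"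
      using bd by (auto intro!: \<gamma>.integrable_const_bound[where B = B])
    have "\<Delta> = \<bar>(\<integral>z. \<psi> (fst z) - \<psi> (snd z) \<partial>\<gamma>)\<bar>"
      unfolding \<Delta>_def fst[symmetric] snd[symmetric]
      using int by (simp add: integral_distr)
    also have "ennreal \<dots> \<le> (\<integral>\<^sup>+z. ennreal \<bar>\<psi> (fst z) - \<psi> (snd z)\<bar> \<partial>\<gamma>)"
      using integral_norm_bound_ennreal[of \<gamma> "\<lambda>z. \<psi> (fst z) - \<psi> (snd z)"] int by simp
    also have "\<dots> \<le> (\<integral>\<^sup>+z. ennreal (L * norm (fst z - snd z)) \<partial>\<gamma>)"
      using lip by (intro nn_integral_mono ennreal_leI) (auto simp: lipschitz_on_def dist_norm)
    finally have "ennreal (\<Delta> powr p) \<le> (\<integral>\<^sup>+z. ennreal ((L * norm (fst z - snd z)) powr p) \<partial>\<gamma>)"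
      using p \<open>0 \<le> L\<close> by (intro \<gamma>.nn_integral_powr_jensen) (auto simp: \<Delta>_def)
    also have "\<dots> = ennreal (L powr p) * (\<integral>\<^sup>+z. ennreal (norm (fst z - snd z) powr p) \<partial>\<gamma>)"
      using \<open>0 \<le> L\<close> by (simp add: powr_mult ennreal_mult nn_integral_cmult)
    finally show ?thesis .
  qed
  define I where "I = (INF \<gamma>\<in>couplings \<mu> \<nu>. \<integral>\<^sup>+z. ennreal (norm (fst z - snd z) powr p) \<partial>\<gamma>)"
  have "I < \<infinity>"
    using product_coupling_finite_cost[OF _ \<mu> \<nu>] p unfolding I_def by (auto simp: INF_less_iff)
  then have I: "I = ennreal (enn2real I)" by simp
  have "\<Delta> powr p \<le> L powr p * enn2real I"
  \<comment> \<open>The general case divides by L^p. For L = 0 one coupling, the product, already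
    forces \<Delta> = 0.\<close>
  proof (cases "L = 0")
    case True
    with key[of "\<mu> \<Otimes>\<^sub>M \<nu>"] product_coupling_finite_cost(1)[OF _ \<mu> \<nu>] p show ?thesis
      by (simp add: \<Delta>_def)
  next
    case False
    with \<open>0 \<le> L\<close> have "0 < L powr p" by simp
    have "ennreal (\<Delta> powr p / L powr p) \<le> I"
      unfolding I_def
    proof (rule INF_greatest)
      fix \<gamma> assume "\<gamma> \<in> couplings \<mu> \<nu>"
      from divide_right_mono_ennreal[OF key[OF this], of "ennreal (L powr p)"]
      show "ennreal (\<Delta> powr p / L powr p) \<le> (\<integral>\<^sup>+z. ennreal (norm (fst z - snd z) powr p) \<partial>\<gamma>)"
        using \<open>0 < L powr p\<close> by (simp add: divide_ennreal mult.commute[of "ennreal (L powr p)"] ennreal_mult_divide_eq)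
    qed
    then have "\<Delta> powr p / L powr p \<le> enn2real I"
      by (subst (asm) I) simp
    then show ?thesis
      using \<open>0 < L powr p\<close> by (simp add: field_simps)
  qed
  then have "(\<Delta> powr p) powr (1/p) \<le> (L powr p * enn2real I) powr (1/p)"
    using p by (intro powr_mono2) auto
  then have "\<Delta> \<le> L * enn2real I powr (1/p)"
    using p \<open>0 \<le> L\<close> by (simp add: powr_mult powr_powr \<Delta>_def)
  then show ?thesis
    by (simp add: \<Delta>_def wasserstein_def I_def)
qed

section \<open>Measurability, stochastic order and real inequalities\<close>

text \<open>Closed sets form an intersection-stable generator of the Borel sets, and the indicator
  of a closed set is a pointwise limit of bounded Lipschitz functions. So the mass of a closed set
  is a limit of functions continuous in time.\<close>

lemma measurable_kernel_if_lipschitz_continuous: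
  fixes \<mu> :: "real \<Rightarrow> 'a::euclidean_space measure"
  assumes prob: "\<And>r. r \<in> {a..b} \<Longrightarrow> prob_space (\<mu> r)"
    and sets: "\<And>r. r \<in> {a..b} \<Longrightarrow> sets (\<mu> r) = sets borel"
    and cont: "\<And>\<psi> L. L-lipschitz_on UNIV \<psi> \<Longrightarrow> (\<And>x. \<bar>\<psi> x\<bar> \<le> 1)
      \<Longrightarrow> continuous_on {a..b} (\<lambda>r. \<integral>x. \<psi> x \<partial>\<mu> r :: real)"
  shows "\<mu> \<in> measurable (lebesgue_on {a..b}) (subprob_algebra borel)"
proof (rule measurable_subprob_algebra_generated[where \<Omega> = UNIV and G = "Collect closed"])
  show "sets (borel :: 'a measure) = sigma_sets UNIV (Collect closed)"
    by (subst borel_eq_closed) simp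
  show "Int_stable (Collect closed :: 'a set set)" by (auto simp: Int_stable_def)
  fix r assume r: "r \<in> space (lebesgue_on {a..b})"
  then show "subprob_space (\<mu> r)" "sets (\<mu> r) = sets borel"
    using prob sets by (auto intro: prob_space_imp_subprob_space)
next
  show "(\<lambda>r. emeasure (\<mu> r) UNIV) \<in> borel_measurable (lebesgue_on {a..b})"
  proof (subst measurable_cong[where g = "\<lambda>_. 1"])
    fix r assume "r \<in> space (lebesgue_on {a..b})"
    then have r: "r \<in> {a..b}" by simp
    then interpret prob_space "\<mu> r" by (rule prob)
    show "emeasure (\<mu> r) UNIV = 1"
      using emeasure_space_1 sets_eq_imp_space_eq[OF sets[OF r]] by simp
  qed simp
next
  fix C :: "'a set" assume "C \<in> Collect closed"
  then have "closed C" by simp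
  show "(\<lambda>r. emeasure (\<mu> r) C) \<in> borel_measurable (lebesgue_on {a..b})"
  \<comment> \<open>By convention \<open>infdist x {} = 0\<close>, so for the empty set the
    functions \<psi> below would tend to 1 instead of 0.\<close>
  proof (cases "C = {}")
    case False
    define \<psi> where "\<psi> n x = max 0 (1 - real n * infdist x C)" for n x
    have bd: "\<bar>\<psi> n x\<bar> \<le> 1" for n x
      by (auto simp: \<psi>_def max_def infdist_nonneg)
    have lip: "(real n)-lipschitz_on UNIV (\<psi> n)" for n
    proof (rule lipschitz_onI)
      fix x y :: 'a
      have "\<bar>\<psi> n x - \<psi> n y\<bar> \<le> \<bar>real n * infdist x C - real n * infdist y C\<bar>"
        by (auto simp: \<psi>_def max_def)
      also have "\<dots> = real n * \<bar>infdist x C - infdist y C\<bar>"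
        by (simp add: abs_mult flip: right_diff_distrib)
      also have "\<dots> \<le> real n * dist x y"
        using infdist_triangle[of x C y] infdist_triangle[of y C x] by (intro mult_left_mono) (auto simp: dist_commute)
      finally show "dist (\<psi> n x) (\<psi> n y) \<le> real n * dist x y" by (simp add: dist_real_def)
    qed simp
    have [measurable]: "\<psi> n \<in> borel_measurable borel" for n
      using lipschitz_on_continuous_on[OF lip] by (rule borel_measurable_continuous_onI)
    have lim: "(\<lambda>n. \<psi> n x) \<longlonglongrightarrow> indicator C x" for x
    proof (cases "x \<in> C")
      case True
      then show ?thesis by (simp add: \<psi>_def)
    next
      case False
      then have "0 < infdist x C"
        using \<open>closed C\<close> \<open>C \<noteq> {}\<close> in_closed_iff_infdist_zero[of C x] infdist_nonneg[of x C] by force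
      then obtain N where N: "1 < real N * infdist x C"
        using reals_Archimedean3 by blast
      have "\<psi> n x = 0" if "N \<le> n" for n
      proof -
        have "real N * infdist x C \<le> real n * infdist x C"
          using that \<open>0 < infdist x C\<close> by (intro mult_right_mono) auto
        with N show ?thesis by (simp add: \<psi>_def)
      qed
      then show ?thesis
        using False by (intro tendsto_eventually) (auto simp: eventually_sequentially)
    qed
    have "(\<lambda>r. measure (\<mu> r) C) \<in> borel_measurable (lebesgue_on {a..b})"
    proof (rule borel_measurable_LIMSEQ_real)
      show "(\<lambda>r. \<integral>x. \<psi> n x \<partial>\<mu> r) \<in> borel_measurable (lebesgue_on {a..b})" for n
        by (rule continuous_imp_measurable_on_sets_lebesgue[OF cont[OF lip bd]]) simp
      fix r assume "r \<in> space (lebesgue_on {a..b})"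
      then have r: "r \<in> {a..b}" by simp
      then interpret prob_space "\<mu> r" by (rule prob)
      note [measurable_cong] = sets[OF r]
      have [measurable]: "C \<in> sets borel" using \<open>closed C\<close> by simp
      have "(\<lambda>n. \<integral>x. \<psi> n x \<partial>\<mu> r) \<longlonglongrightarrow> (\<integral>x. indicator C x \<partial>\<mu> r)"
        using lim bd \<open>closed C\<close>
        by (intro integral_dominated_convergence[where w = "\<lambda>_. 1"]) auto
      then show "(\<lambda>n. \<integral>x. \<psi> n x \<partial>\<mu> r) \<longlonglongrightarrow> measure (\<mu> r) C"
        using \<open>closed C\<close> sets[OF r] sets_eq_imp_space_eq[OF sets[OF r]] by simp
    qed
    then have "(\<lambda>r. ennreal (measure (\<mu> r) C)) \<in> borel_measurable (lebesgue_on {a..b})" by simp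
    then show ?thesis
    proof (rule measurable_cong[THEN iffD1, rotated])
      fix r assume "r \<in> space (lebesgue_on {a..b})"
      then interpret prob_space "\<mu> r" using prob by simp
      show "ennreal (measure (\<mu> r) C) = emeasure (\<mu> r) C" by (simp add: emeasure_eq_measure)
    qed
  qed simp
qed auto

lemma integral_kernel_measurable:
  fixes f :: "'b \<Rightarrow> 'a::euclidean_space \<Rightarrow> real"
  assumes f[measurable]: "(\<lambda>(t, x). f t x) \<in> borel_measurable (M \<Otimes>\<^sub>M borel)"
    and L: "L \<in> measurable M (subprob_algebra borel)"
  shows "(\<lambda>t. \<integral>x. f t x \<partial>L t) \<in> borel_measurable M"
proof -
  have [measurable]: "(\<lambda>t. \<integral>\<^sup>+x. ennreal (f t x) \<partial>L t) \<in> borel_measurable M"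
    "(\<lambda>t. \<integral>\<^sup>+x. ennreal (- f t x) \<partial>L t) \<in> borel_measurable M"
    "(\<lambda>t. \<integral>\<^sup>+x. ennreal \<bar>f t x\<bar> \<partial>L t) \<in> borel_measurable M"
    by (rule nn_integral_measurable_subprob_algebra2[OF _ L], measurable)+
  \<comment> \<open>The guard reproduces the default value 0 of the Bochner integral at parameters
    where \<open>f t\<close> is not integrable.\<close>
  have "(\<lambda>t. if (\<integral>\<^sup>+x. ennreal \<bar>f t x\<bar> \<partial>L t) < \<infinity> then
      enn2real (\<integral>\<^sup>+x. ennreal (f t x) \<partial>L t) - enn2real (\<integral>\<^sup>+x. ennreal (- f t x) \<partial>L t) else 0)
      \<in> borel_measurable M"
    by measurable
  then show ?thesis
  proof (rule measurable_cong[THEN iffD1, rotated])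
    fix t assume t: "t \<in> space M"
    have "sets (L t) = sets borel"
      using measurable_space[OF L t] by (simp add: space_subprob_algebra)
    then have [measurable]: "f t \<in> borel_measurable (L t)"
      using measurable_Pair2[OF f t] measurable_cong_sets[of "L t" borel borel borel] by simp
    show "(if (\<integral>\<^sup>+x. ennreal \<bar>f t x\<bar> \<partial>L t) < \<infinity> then
        enn2real (\<integral>\<^sup>+x. ennreal (f t x) \<partial>L t) - enn2real (\<integral>\<^sup>+x. ennreal (- f t x) \<partial>L t) else 0)
        = (\<integral>x. f t x \<partial>L t)"
      by (auto simp: real_lebesgue_integral_def integrable_iff_bounded not_integrable_integral_eq)
  qed
qed

lemma
  fixes f :: "real \<Rightarrow> real"
  assumes f: "set_integrable lebesgue {a..b} f"
  shows set_integral_diff_interval: "\<lbrakk>a \<le> s; s \<le> t; t \<le> b\<rbrakk> \<Longrightarrow>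
      (LINT r:{s..t}|lebesgue. f r) = (LINT r:{a..t}|lebesgue. f r) - (LINT r:{a..s}|lebesgue. f r)"
    and continuous_on_set_integral: "continuous_on {a..b} (\<lambda>t. LINT r:{a..t}|lebesgue. f r)"
proof -
  have eq: "(LINT r:{s..t}|lebesgue. f r) = integral {s..t} f" if "a \<le> s" "t \<le> b" for s t
    using that by (intro set_lebesgue_integral_eq_integral set_integrable_subset[OF f]) auto
  have int: "f integrable_on {a..b}"
    using f by (rule set_lebesgue_integral_eq_integral)
  show "(LINT r:{s..t}|lebesgue. f r) = (LINT r:{a..t}|lebesgue. f r) - (LINT r:{a..s}|lebesgue. f r)"
    if "a \<le> s" "s \<le> t" "t \<le> b"
    using that Henstock_Kurzweil_Integration.integral_combine[of a s t f] integrable_on_subinterval[OF int, of a t]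
    by (simp add: eq)
  show "continuous_on {a..b} (\<lambda>t. LINT r:{a..t}|lebesgue. f r)"
    using indefinite_integral_continuous_1[OF int] by (rule continuous_on_eq) (simp add: eq)
qed

text \<open>Cutting \<open>[a, b]\<close> into \<open>n\<close> pieces with equal increments of \<open>H\<close>, the total increment of \<open>f\<close>
  is \<open>O(1/n)\<close>.\<close>

lemma le_if_increments_quadratic:
  fixes f H :: "real \<Rightarrow> real"
  assumes "a \<le> b" and cont: "continuous_on {a..b} H" and mono: "mono_on {a..b} H"
    and inc: "\<And>s t. \<lbrakk>a \<le> s; s \<le> t; t \<le> b\<rbrakk> \<Longrightarrow> f t - f s \<le> C * (H t - H s)\<^sup>2"
  shows "f b \<le> f a"
proof -
  define d where "d = H b - H a"
  have "0 \<le> d" using mono_onD[OF mono, of a b] \<open>a \<le> b\<close> by (simp add: d_def)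
  show ?thesis
  proof (cases "d = 0")
    case True
    then show ?thesis using inc[of a b] \<open>a \<le> b\<close> by (simp add: d_def)
  next
    case False
    with \<open>0 \<le> d\<close> have "0 < d" by simp
    have bound: "f b - f a \<le> (C * d\<^sup>2) * inverse (real (Suc k))" for k
    proof -
      define n where "n = Suc k"
      have "0 < n" by (simp add: n_def)
      have "\<exists>x. a \<le> x \<and> x \<le> b \<and> H x = H a + real i / real n * d" if "i \<le> n" for i
      proof (rule IVT'[OF _ _ \<open>a \<le> b\<close> cont])
        show "H a \<le> H a + real i / real n * d" using \<open>0 \<le> d\<close> by simp
        have "real i / real n * d \<le> 1 * d"
          using that \<open>0 < n\<close> \<open>0 \<le> d\<close> by (intro mult_right_mono) auto
        then show "H a + real i / real n * d \<le> H b" by (simp add: d_def)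
      qed
      then obtain x where x: "\<And>i. i \<le> n \<Longrightarrow> a \<le> x i \<and> x i \<le> b \<and> H (x i) = H a + real i / real n * d"
        by metis
      have step: "f (x (Suc i)) - f (x i) \<le> C * (d / real n)\<^sup>2" if "i < n" for i
      proof -
        have eq: "H (x (Suc i)) - H (x i) = d / real n"
          using that x[of i] x[of "Suc i"] \<open>0 < n\<close> by (simp add: field_simps)
        then have "x i \<le> x (Suc i)"
          using mono_onD[OF mono, of "x (Suc i)" "x i"] that x[of i] x[of "Suc i"] \<open>0 < d\<close> \<open>0 < n\<close>
          by (smt (verit) Suc_leI atLeastAtMost_iff divide_pos_pos less_imp_le_nat of_nat_0_less_iff)
        then show ?thesis
          using inc[of "x i" "x (Suc i)"] that x[of i] x[of "Suc i"] eq by simp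
      qed
      have "f (x n) - f (x 0) = (\<Sum>i<n. f (x (Suc i)) - f (x i))"
        by (rule sum_lessThan_telescope[of "\<lambda>i. f (x i)", symmetric])
      also have "\<dots> \<le> (\<Sum>i<n. C * (d / real n)\<^sup>2)"
        by (intro sum_mono step) simp
      also have "\<dots> = (C * d\<^sup>2) * inverse (real n)"
        using \<open>0 < n\<close> by (simp add: field_simps power2_eq_square)
      finally have "f (x n) - f (x 0) \<le> (C * d\<^sup>2) * inverse (real n)" .
      \<comment> \<open>The intermediate value theorem need not return \<open>a\<close> for
        \<open>x 0\<close> or \<open>b\<close> for \<open>x n\<close>. Since \<open>H\<close> takes
        the same values there, the quadratic bound for these two gaps is 0.\<close>
      moreover have "f (x 0) - f a \<le> 0"
        using inc[of a "x 0"] x[of 0] by simp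
      moreover have "f b - f (x n) \<le> 0"
        using inc[of "x n" b] x[of n] \<open>0 < n\<close> by (simp add: d_def)
      ultimately show ?thesis by (simp add: n_def)
    qed
    have "(\<lambda>k. (C * d\<^sup>2) * inverse (real (Suc k))) \<longlonglongrightarrow> (C * d\<^sup>2) * 0"
      by (intro tendsto_intros LIMSEQ_inverse_real_of_nat)
    then have "f b - f a \<le> (C * d\<^sup>2) * 0"
      by (rule LIMSEQ_le_const) (use bound in auto)
    then show ?thesis by simp
  qed
qed

lemma up_set_real_cases:
  fixes U :: "real set"
  assumes up: "\<And>x y. x \<in> U \<Longrightarrow> x \<le> y \<Longrightarrow> y \<in> U"
  obtains "U = {}" | "U = UNIV" | q where "U = {q..}" | q where "U = {q<..}"
proof -
  consider "U = {}" | "U = UNIV" | "U \<noteq> {}" "U \<noteq> UNIV" by blast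
  then show thesis
  proof cases
    case 3
    then obtain z where "z \<notin> U" by auto
    then have bdd: "bdd_below U" using up by (intro bdd_belowI[of _ z]) (meson linear)
    have above: "y \<in> U" if "Inf U < y" for y
      using that cInf_less_iff[OF \<open>U \<noteq> {}\<close> bdd] up by (meson less_imp_le)
    have below: "Inf U \<le> y" if "y \<in> U" for y
      using that bdd by (rule cInf_lower)
    show thesis
    proof (cases "Inf U \<in> U")
      case True
      then have "U = {Inf U..}" using below up by auto
      then show thesis by (rule that)
    next
      case False
      then have "U = {Inf U<..}" using below above by (force simp: less_le)
      then show thesis by (rule that)
    qed
  qed (auto intro: that)
qed

text \<open>By the layer-cake formula, the integral of h(X) is the integral over u > 0 of the mass
  of {h(X) > u}. For monotone h these are preimages of up-sets of the line, that is of half-lines,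
  so comparing tails suffices and h may jump. The restriction to u > 0 matches
  \<open>ennreal\<close>, which sends negative values to 0.\<close>

lemma nn_integral_mono_stochastic_order:
  fixes X :: "'a \<Rightarrow> real" and Y :: "'b \<Rightarrow> real" and h :: "real \<Rightarrow> real"
  assumes M: "prob_space M" and N: "prob_space N"
    and X[measurable]: "X \<in> borel_measurable M" and Y[measurable]: "Y \<in> borel_measurable N"
    and dom: "\<And>q. emeasure M {x \<in> space M. q \<le> X x} \<le> emeasure N {x \<in> space N. q \<le> Y x}"
    and h: "mono h"
  shows "(\<integral>\<^sup>+x. ennreal (h (X x)) \<partial>M) \<le> (\<integral>\<^sup>+x. ennreal (h (Y x)) \<partial>N)"
proof -
  interpret M: prob_space M by fact
  interpret N: prob_space N by fact
  note [measurable] = borel_measurable_mono[OF h]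
  have up_set: "emeasure M {x \<in> space M. X x \<in> U} \<le> emeasure N {x \<in> space N. Y x \<in> U}"
    if "\<And>x y. x \<in> U \<Longrightarrow> x \<le> y \<Longrightarrow> y \<in> U" for U
  proof -
    from that consider "U = {}" | "U = UNIV" | q where "U = {q..}" | q where "U = {q<..}"
      by (rule up_set_real_cases)
    then show ?thesis
    proof cases
      case (4 q)
      \<comment> \<open>An open half-line is the increasing union of closed ones, for which the
        comparison is the hypothesis.\<close>
      have *: "emeasure K {x \<in> space K. Z x \<in> U} = (SUP n. emeasure K {x \<in> space K. q + inverse (real (Suc n)) \<le> Z x})"
        if [measurable]: "Z \<in> borel_measurable K" for K :: "'c measure" and Z
      proof (subst SUP_emeasure_incseq)
        have *: "inverse (real (Suc j)) \<le> inverse (real (Suc i))" if "i \<le> j" for i j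
          using that by (simp add: field_simps)
        show "incseq (\<lambda>n. {x \<in> space K. q + inverse (real (Suc n)) \<le> Z x})"
          unfolding incseq_def
        proof (intro allI impI subsetI)
          fix i j :: nat and x
          assume "i \<le> j" "x \<in> {x \<in> space K. q + inverse (real (Suc i)) \<le> Z x}"
          then have "x \<in> space K" "q + inverse (real (Suc i)) \<le> Z x" by blast+
          with *[OF \<open>i \<le> j\<close>] show "x \<in> {x \<in> space K. q + inverse (real (Suc j)) \<le> Z x}"
            by (intro CollectI conjI) (assumption, linarith)
        qed
        have "{x \<in> space K. Z x \<in> U} = (\<Union>n. {x \<in> space K. q + inverse (real (Suc n)) \<le> Z x})"
        proof (intro set_eqI iffI)
          fix x assume "x \<in> {x \<in> space K. Z x \<in> U}"
          then have "x \<in> space K" "0 < Z x - q" using 4 by auto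
          then obtain n where "inverse (real (Suc n)) < Z x - q"
            using reals_Archimedean by blast
          with \<open>x \<in> space K\<close> show "x \<in> (\<Union>n. {x \<in> space K. q + inverse (real (Suc n)) \<le> Z x})"
            by (auto intro!: exI[of _ n])
        next
          fix x assume "x \<in> (\<Union>n. {x \<in> space K. q + inverse (real (Suc n)) \<le> Z x})"
          then obtain n where "x \<in> space K" "q + inverse (real (Suc n)) \<le> Z x" by blast
          moreover from this(2) have "q < Z x"
            by (rule less_le_trans[rotated]) simp
          ultimately show "x \<in> {x \<in> space K. Z x \<in> U}" using 4 by simp
        qed
        then show "emeasure K {x \<in> space K. Z x \<in> U} = emeasure K (\<Union>n. {x \<in> space K. q + inverse (real (Suc n)) \<le> Z x})"
          by simp
      qed auto
      show ?thesis
        unfolding *[OF X] *[OF Y] by (intro SUP_mono) (auto intro: dom)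
    qed (auto simp: M.emeasure_space_1 N.emeasure_space_1 intro: dom)
  qed
  have layer: "(\<integral>\<^sup>+x. ennreal (h (Z x)) \<partial>K) =
      (\<integral>\<^sup>+u. indicator {0<..} u * emeasure K {x \<in> space K. Z x \<in> {y. u < h y}} \<partial>lborel)"
    if "prob_space K" and [measurable]: "Z \<in> borel_measurable K" for K :: "'c measure" and Z
  proof -
    interpret K: prob_space K by fact
    interpret pair_sigma_finite K lborel ..
    have "(\<integral>\<^sup>+x. ennreal (h (Z x)) \<partial>K) = (\<integral>\<^sup>+x. \<integral>\<^sup>+u. indicator {0<..<h (Z x)} u \<partial>lborel \<partial>K)"
    proof (intro nn_integral_cong)
      fix x show "ennreal (h (Z x)) = (\<integral>\<^sup>+u. indicator {0<..<h (Z x)} u \<partial>lborel)"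
        by (cases "0 \<le> h (Z x)") (auto simp: ennreal_neg)
    qed
    also have "\<dots> = (\<integral>\<^sup>+x. \<integral>\<^sup>+u. indicator {0<..} u * indicator {x \<in> space K. u < h (Z x)} x \<partial>lborel \<partial>K)"
      by (intro nn_integral_cong) (auto split: split_indicator)
    also have "\<dots> = (\<integral>\<^sup>+u. \<integral>\<^sup>+x. indicator {0<..} u * indicator {x \<in> space K. u < h (Z x)} x \<partial>K \<partial>lborel)"
      by (rule Fubini'[symmetric]) measurable
    also have "\<dots> = (\<integral>\<^sup>+u. indicator {0<..} u * emeasure K {x \<in> space K. Z x \<in> {y. u < h y}} \<partial>lborel)"
      by (intro nn_integral_cong) (simp add: nn_integral_cmult)
    finally show ?thesis .
  qed
  show ?thesis
    unfolding layer[OF M X] layer[OF N Y]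
    using monoD[OF h] by (intro nn_integral_mono mult_left_mono up_set) (auto intro: less_le_trans)
qed

section \<open>Test functions\<close>

text \<open>If \<open>D\<close> is a step from \<open>0\<close> (on \<open>y \<le> 0\<close>) to \<open>1\<close> (on \<open>y \<ge> 1\<close>), then
  \<open>radial D \<delta> \<sigma> x\<close> is \<open>1\<close> for \<open>|x| \<ge> \<sigma>\<close> and \<open>0\<close> for \<open>|x|\<^sup>2 \<le> \<sigma>\<^sup>2 - \<delta>\<close>.\<close>

definition radial :: "(real \<Rightarrow> real) \<Rightarrow> real \<Rightarrow> real \<Rightarrow> 'a::euclidean_space \<Rightarrow> real" where
  "radial D \<delta> \<sigma> x = D ((x \<bullet> x - \<sigma>\<^sup>2) / \<delta> + 1)"

lemma radial_has_derivative:
  assumes "\<And>y. (D has_field_derivative D' y) (at y)" and "\<delta> \<noteq> 0"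
  shows "(radial D \<delta> \<sigma> has_derivative (\<lambda>h. (radial D' \<delta> \<sigma> x * (2 / \<delta>)) *\<^sub>R x \<bullet> h)) (at x)"
proof -
  have "((\<lambda>x::'a. (x \<bullet> x - \<sigma>\<^sup>2) / \<delta> + 1) has_derivative (\<lambda>h. (2 / \<delta>) * (x \<bullet> h))) (at x)"
    using \<open>\<delta> \<noteq> 0\<close>
    by (auto intro!: derivative_eq_intros simp: inner_commute fun_eq_iff add_divide_distrib[symmetric])
  moreover have "(D has_derivative (*) (D' ((x \<bullet> x - \<sigma>\<^sup>2) / \<delta> + 1))) (at ((x \<bullet> x - \<sigma>\<^sup>2) / \<delta> + 1))"
    using assms by (simp add: has_field_derivative_def)
  ultimately have "((\<lambda>x::'a. D ((x \<bullet> x - \<sigma>\<^sup>2) / \<delta> + 1)) has_derivative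
      (\<lambda>h. D' ((x \<bullet> x - \<sigma>\<^sup>2) / \<delta> + 1) * ((2 / \<delta>) * (x \<bullet> h)))) (at x)"
    by (rule has_derivative_compose)
  then show ?thesis
    by (simp add: radial_def[abs_def] mult.assoc)
qed

text \<open>Meant for derivatives of the step, which vanish from 1 on: the layer on which a radial
  cut-off varies lies inside the ball of radius \<sigma>.\<close>

lemma radial_eq_0_if_norm_gt:
  assumes "0 < \<delta>" "0 \<le> \<sigma>" "\<And>y. 1 \<le> y \<Longrightarrow> D y = 0" "\<sigma> \<le> norm x"
  shows "radial D \<delta> \<sigma> x = 0"
proof -
  have "\<sigma>\<^sup>2 \<le> x \<bullet> x"
    using power_mono[OF assms(4,2), of 2] by (simp add: power2_norm_eq_inner)
  then show ?thesis
    using assms by (simp add: radial_def)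
qed

text \<open>The gradient of |x|^2 is unbounded, but the derivative of \<open>D\<close> vanishes
  outside the ball of radius \<sigma>, so |x| counts only up to \<sigma>. Stating the constant with
  an upper bound \<open>Y\<close> lets it serve for all radii at once.\<close>

lemma radial_lipschitz:
  assumes deriv: "\<And>y. (D has_field_derivative D' y) (at y)"
    and D': "\<And>y. \<bar>D' y\<bar> \<le> M" "\<And>y. 1 \<le> y \<Longrightarrow> D' y = 0" and "0 < \<delta>" "0 \<le> \<sigma>" "\<sigma> \<le> Y"
  shows "(2 * M * Y / \<delta>)-lipschitz_on UNIV (radial D \<delta> \<sigma> :: 'a::euclidean_space \<Rightarrow> real)"
proof (rule bounded_derivative_imp_lipschitz[where f' = "\<lambda>x h. (radial D' \<delta> \<sigma> x * (2 / \<delta>)) *\<^sub>R x \<bullet> h"])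
  have M: "0 \<le> M" using D'(1)[of 0] by linarith
  then show "0 \<le> 2 * M * Y / \<delta>" using assms by auto
  show "(radial D \<delta> \<sigma> has_derivative (\<lambda>h. (radial D' \<delta> \<sigma> x * (2 / \<delta>)) *\<^sub>R x \<bullet> h)) (at x within UNIV)" for x :: 'a
    using radial_has_derivative[OF deriv, of \<delta> \<sigma> x] \<open>0 < \<delta>\<close> by simp
  fix x :: 'a
  have "\<bar>radial D' \<delta> \<sigma> x\<bar> * norm x \<le> M * Y"
  proof (cases "\<sigma> \<le> norm x")
    case True
    then have "radial D' \<delta> \<sigma> x = 0"
      using assms by (intro radial_eq_0_if_norm_gt) auto
    then show ?thesis using M assms by simp
  next
    case False
    then show ?thesis
      using assms M by (intro mult_mono) (auto simp: radial_def)
  qed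
  then have "norm ((radial D' \<delta> \<sigma> x * (2 / \<delta>)) *\<^sub>R x) \<le> 2 * M * Y / \<delta>"
    using \<open>0 < \<delta>\<close> by (simp add: abs_mult field_simps)
  then have "norm ((radial D' \<delta> \<sigma> x * (2 / \<delta>)) *\<^sub>R x \<bullet> h) \<le> (2 * M * Y / \<delta>) * norm h" for h
    by (intro order_trans[OF Cauchy_Schwarz_ineq2, folded real_norm_def] mult_right_mono) auto
  then show "onorm ((\<bullet>) ((radial D' \<delta> \<sigma> x * (2 / \<delta>)) *\<^sub>R x)) \<le> 2 * M * Y / \<delta>"
    by (rule onorm_le)
qed simp

lemma gradient_eqI:
  assumes "(f has_derivative (\<lambda>h. g \<bullet> h)) (at x)"
  shows "gradient f x = g"
proof -
  have "frechet_derivative f (at x) = (\<bullet>) g"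
    using frechet_derivative_at[OF assms] by simp
  then show ?thesis
    by (simp add: gradient_def euclidean_representation)
qed

lemma C_k_affine: "C_k k f \<Longrightarrow> C_k k (\<lambda>z. c * f z + d)"
  by (intro C_k_add[of k "\<lambda>z. c * f z"] C_k_mult C_k_const)

lemma C_k_inner_self: "C_k k (\<lambda>z::real \<times> 'a::euclidean_space. snd z \<bullet> snd z)"
proof -
  have "C_k k (\<lambda>z::real \<times> 'a. \<Sum>b\<in>Basis. (snd z \<bullet> b) * (snd z \<bullet> b))"
    by (intro C_k_sum C_k_mult C_k_bounded_linear bounded_linear_compose[OF bounded_linear_inner_left] bounded_linear_snd)
  then show ?thesis by (subst euclidean_inner)
qed

text \<open>The time cut-off rises on \<open>[s + e, s + 2 e]\<close> and falls on \<open>[t - 2 e, t - e]\<close>.\<close>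

definition time_cutoff :: "(real \<Rightarrow> real) \<Rightarrow> real \<Rightarrow> real \<Rightarrow> real \<Rightarrow> real \<Rightarrow> real" where
  "time_cutoff S e s t r = S ((r - s) / e - 1) - S ((r - t) / e + 2)"

locale smooth_step =
  fixes S :: "real \<Rightarrow> real"
  assumes smooth: "smooth S"
    and zero: "\<And>x. x \<le> 0 \<Longrightarrow> S x = 0"
    and one: "\<And>x. 1 \<le> x \<Longrightarrow> S x = 1"
    and deriv_nonneg: "\<And>x. 0 \<le> deriv S x"
begin

abbreviation "S' \<equiv> deriv S"
abbreviation "S'' \<equiv> deriv S'"

lemma has_deriv: "(S has_field_derivative S' x) (at x)"
  and has_deriv2: "(S' has_field_derivative S'' x) (at x)"
  and has_deriv3: "(S'' has_field_derivative deriv S'' x) (at x)"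
  using smooth smooth_real_deriv by auto

lemma mono: "x \<le> y \<Longrightarrow> S x \<le> S y"
  by (rule DERIV_nonneg_imp_nondecreasing) (use has_deriv deriv_nonneg in blast)+

lemma bounds: "0 \<le> S x" "S x \<le> 1"
  using mono[of 0 x] mono[of x 0] mono[of x 1] mono[of 1 x] zero one
  by (metis linear order_refl)+

text \<open>Outside [0, 1] the step is locally constant. At the end points 0 and 1 it is not, but
  there it attains its minimum and its maximum.\<close>

lemma deriv_eq_0:
  assumes "x \<le> 0 \<or> 1 \<le> x"
  shows "S' x = 0"
proof -
  have "S' x = 0" if "x < 0 \<or> 1 < x" for x
    using that
  proof
    assume "x < 0"
    have "(S has_field_derivative 0) (at x)"
      by (rule has_field_derivative_transform_within_open[where f = "\<lambda>_. 0" and S = "{..<0}"])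
         (use \<open>x < 0\<close> zero in auto)
    then show ?thesis by (rule DERIV_imp_deriv)
  next
    assume "1 < x"
    have "(S has_field_derivative 0) (at x)"
      by (rule has_field_derivative_transform_within_open[where f = "\<lambda>_. 1" and S = "{1<..}"])
         (use \<open>1 < x\<close> one in auto)
    then show ?thesis by (rule DERIV_imp_deriv)
  qed
  moreover have "S' 0 = 0"
  proof (rule DERIV_local_min[OF has_deriv, of 1])
    show "\<forall>y. \<bar>0 - y\<bar> < 1 \<longrightarrow> S 0 \<le> S y" using bounds zero by simp
  qed simp
  moreover have "S' 1 = 0"
  proof (rule DERIV_local_max[OF has_deriv, of 1])
    show "\<forall>y. \<bar>1 - y\<bar> < 1 \<longrightarrow> S y \<le> S 1" using bounds one by simp
  qed simp
  ultimately show ?thesis using assms by (auto simp: less_le)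
qed

text \<open>Being nonnegative, \<open>S'\<close> has a minimum wherever it vanishes, so its
  derivative is 0 there; this covers the end points as well.\<close>

lemma deriv2_eq_0:
  assumes "x \<le> 0 \<or> 1 \<le> x"
  shows "S'' x = 0"
proof -
  have "S'' x = 0"
    by (rule DERIV_local_min[OF has_deriv2, of 1]) (use assms deriv_eq_0 deriv_nonneg in auto)
  then show ?thesis .
qed

lemma deriv_bounded: "\<exists>M. \<forall>x. S' x \<le> M \<and> \<bar>S'' x\<bar> \<le> M"
proof -
  have "continuous_on {0..1} S'" "continuous_on {0..1} S''"
    using has_deriv2 has_deriv3 by (auto intro!: continuous_at_imp_continuous_on DERIV_isCont)
  then have "compact (S' ` {0..1})" "compact (S'' ` {0..1})"
    by (auto intro: compact_continuous_image)
  then obtain M1 M2 where "\<forall>x\<in>S' ` {0..1}. norm x \<le> M1" "\<forall>x\<in>S'' ` {0..1}. norm x \<le> M2"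
    by (meson compact_imp_bounded bounded_iff)
  then have M: "\<And>x. x \<in> {0..1} \<Longrightarrow> \<bar>S' x\<bar> \<le> M1" "\<And>x. x \<in> {0..1} \<Longrightarrow> \<bar>S'' x\<bar> \<le> M2"
    by auto
  have "S' x \<le> max M1 M2 \<and> \<bar>S'' x\<bar> \<le> max M1 M2" for x
  proof (cases "x \<in> {0..1}")
    case True
    then show ?thesis using M[OF True] by auto
  next
    case False
    then show ?thesis using M[of 0] deriv_eq_0[of x] deriv2_eq_0[of x] by auto
  qed
  then show ?thesis by blast
qed

lemma continuous: "continuous_on UNIV S" "continuous_on UNIV S'"
  using has_deriv has_deriv2 by (auto intro!: continuous_at_imp_continuous_on DERIV_isCont)

lemma affine_has_deriv:
  assumes "e \<noteq> 0"
  shows "((\<lambda>r. S ((r - c) / e + d)) has_field_derivative S' ((r - c) / e + d) / e) (at r)"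
proof -
  have "((\<lambda>r. (r - c) / e + d) has_field_derivative 1 / e) (at r)"
    using assms by (auto intro!: derivative_eq_intros)
  from DERIV_chain2[OF has_deriv this] show ?thesis by simp
qed

text \<open>A Taylor bound with quadratic remainder, from two applications of the mean value
  theorem. It will be used with \<open>d\<close> the increase of the squared radius divided by
  \<delta>, and it produces one of the two kinds of quadratic error.\<close>

lemma shift_le:
  assumes M: "\<And>x. \<bar>S'' x\<bar> \<le> M" and "0 \<le> d"
  shows "S (q - d) \<le> S q - d * S' q + M * d\<^sup>2"
proof (cases "d = 0")
  case False
  with assms have "q - d < q" by simp
  then obtain z where z: "q - d < z" "z < q" "S q - S (q - d) = (q - (q - d)) * S' z"
    using MVT2[of "q - d" q S S'] has_deriv by blast
  obtain w where w: "S' q - S' z = (q - z) * S'' w"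
    using MVT2[OF z(2), of S' S''] has_deriv2 by blast
  have "S' q - S' z \<le> (q - z) * M"
    unfolding w using z M[of w] by (intro mult_left_mono) auto
  also have "\<dots> \<le> d * M"
    using z M[of w] by (intro mult_right_mono) auto
  finally have "S' q - S' z \<le> d * M" .
  then have "d * (S' q - S' z) \<le> d * (d * M)"
    using \<open>0 \<le> d\<close> by (rule mult_left_mono)
  then show ?thesis
    using z(3) by (simp add: algebra_simps power2_eq_square)
qed simp

lemma time_cutoff_bounds:
  assumes "0 < e" "s + 3 * e \<le> t"
  shows "0 \<le> time_cutoff S e s t r" "time_cutoff S e s t r \<le> 1"
    and "r \<le> s + e \<or> t - e \<le> r \<Longrightarrow> time_cutoff S e s t r = 0"
proof -
  have "(r - t) / e + 2 \<le> (r - s) / e - 1"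
  proof -
    have "3 \<le> (t - s) / e" using assms by (simp add: pos_le_divide_eq)
    then show ?thesis by (simp add: diff_divide_distrib)
  qed
  then show "0 \<le> time_cutoff S e s t r"
    using mono by (simp add: time_cutoff_def)
  show "time_cutoff S e s t r \<le> 1"
    using bounds[of "(r - s) / e - 1"] bounds[of "(r - t) / e + 2"] by (simp add: time_cutoff_def)
  assume "r \<le> s + e \<or> t - e \<le> r"
  then show "time_cutoff S e s t r = 0"
  proof
    assume "r \<le> s + e"
    then have "(r - s) / e - 1 \<le> 0" "(r - t) / e + 2 \<le> 0" using assms by (simp_all add: field_simps)
    then show ?thesis by (simp add: time_cutoff_def zero)
  next
    assume "t - e \<le> r"
    then have "1 \<le> (r - s) / e - 1" "1 \<le> (r - t) / e + 2" using assms by (simp_all add: field_simps)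
    then show ?thesis by (simp add: time_cutoff_def one)
  qed
qed

lemma time_cutoff_has_deriv:
  assumes "0 < e"
  shows "(time_cutoff S e s t has_field_derivative (S' ((r - s) / e - 1) / e - S' ((r - t) / e + 2) / e)) (at r)"
  unfolding time_cutoff_def[abs_def]
  using assms by (auto intro!: derivative_eq_intros DERIV_chain2[OF has_deriv])

text \<open>The step equals 1 far out, so its complement is the compactly supported factor; total
  mass one translates between the two. The margin \<open>e\<close> at both ends of the time interval
  keeps the closed support inside the open set even when s = a or t = b.\<close>

lemma cutoff_test_function:
  assumes "0 < \<delta>" "0 \<le> \<sigma>" "0 < e" "s + 3 * e \<le> t" "a \<le> s" "t \<le> b"
  shows "(\<lambda>z. time_cutoff S e s t (fst z) * (1 - radial S \<delta> \<sigma> (snd z)))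
      \<in> test_functions ({a<..<b} \<times> (UNIV :: 'a::euclidean_space set))"
proof -
  define \<phi> :: "real \<times> 'a \<Rightarrow> real"
    where "\<phi> z = time_cutoff S e s t (fst z) * (1 - radial S \<delta> \<sigma> (snd z))" for z
  have S: "C_k k S" for k using smooth by blast
  have "C_k k \<phi>" for k
  proof -
    have fst: "C_k k (\<lambda>z::real \<times> 'a. fst z)" by (intro C_k_bounded_linear bounded_linear_fst)
    have 1: "C_k k (\<lambda>z::real \<times> 'a. S ((1 / e) * fst z + (- s / e - 1)))"
      "C_k k (\<lambda>z::real \<times> 'a. S ((1 / e) * fst z + (- t / e + 2)))"
      "C_k k (\<lambda>z::real \<times> 'a. S ((1 / \<delta>) * (snd z \<bullet> snd z) + (1 - \<sigma>\<^sup>2 / \<delta>)))"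
      by (rule C_k_compose[OF S C_k_affine[OF fst]] C_k_compose[OF S C_k_affine[OF C_k_inner_self]])+
    have "C_k k (\<lambda>z::real \<times> 'a. (S ((1 / e) * fst z + (- s / e - 1)) + (-1) * S ((1 / e) * fst z + (- t / e + 2)))
        * (1 + (-1) * S ((1 / \<delta>) * (snd z \<bullet> snd z) + (1 - \<sigma>\<^sup>2 / \<delta>))))"
      by (rule C_k_mult[OF C_k_add[OF 1(1) C_k_mult[OF C_k_const 1(2)]] C_k_add[OF C_k_const C_k_mult[OF C_k_const 1(3)]]])
    moreover have "\<phi> = (\<lambda>z. (S ((1 / e) * fst z + (- s / e - 1)) + (-1) * S ((1 / e) * fst z + (- t / e + 2)))
        * (1 + (-1) * S ((1 / \<delta>) * (snd z \<bullet> snd z) + (1 - \<sigma>\<^sup>2 / \<delta>))))"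
      by (simp add: \<phi>_def time_cutoff_def radial_def fun_eq_iff diff_divide_distrib algebra_simps)
    ultimately show ?thesis by simp
  qed
  have supp: "{z. \<phi> z \<noteq> 0} \<subseteq> {s + e..t - e} \<times> cball 0 \<sigma>"
  proof clarsimp
    fix r and x :: 'a assume *: "\<phi> (r, x) \<noteq> 0"
    then have "time_cutoff S e s t r \<noteq> 0" by (auto simp: \<phi>_def)
    then have "s + e \<le> r" "r \<le> t - e" using time_cutoff_bounds(3)[of e s t r] assms by force+
    moreover have "norm x \<le> \<sigma>"
    proof (rule ccontr)
      assume "\<not> norm x \<le> \<sigma>"
      then have "\<sigma>\<^sup>2 \<le> x \<bullet> x"
        using power_mono[of \<sigma> "norm x" 2] assms by (simp add: power2_norm_eq_inner)
      then have "radial S \<delta> \<sigma> x = 1"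
        using assms by (simp add: radial_def one)
      with * show False by (simp add: \<phi>_def)
    qed
    ultimately show "s + e \<le> r \<and> r \<le> t - e \<and> norm x \<le> \<sigma>" by simp
  qed
  have cpt: "compact ({s + e..t - e} \<times> cball (0::'a) \<sigma>)" by (intro compact_Times) auto
  have "closure {z. \<phi> z \<noteq> 0} \<subseteq> {s + e..t - e} \<times> cball 0 \<sigma>"
    using supp compact_imp_closed[OF cpt] by (rule closure_minimal)
  moreover from this have "compact (closure {z. \<phi> z \<noteq> 0})"
    using cpt by (meson compact_Int_closed closed_closure inf.absorb_iff2 compact_closure bounded_subset compact_imp_bounded bounded_closure closure_subset supp)
  moreover have "{s + e..t - e} \<times> cball 0 \<sigma> \<subseteq> {a<..<b} \<times> (UNIV :: 'a set)"
    using assms by auto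
  ultimately have "\<phi> \<in> test_functions ({a<..<b} \<times> UNIV)"
    using \<open>\<And>k. C_k k \<phi>\<close> by (auto simp: test_functions_def)
  then show ?thesis by (simp add: \<phi>_def[abs_def])
qed

end

section \<open>Radial transport along the continuity equation\<close>

lemma set_integral_eq_lebesgue_on:
  fixes f :: "real \<Rightarrow> real"
  assumes "S \<in> sets lebesgue"
  shows "(LINT r:S|lebesgue. f r) = integral\<^sup>L (lebesgue_on S) f"
  using assms by (simp add: set_lebesgue_integral_def integral_restrict_space)

lemma set_integrable_iff_lebesgue_on:
  fixes f :: "real \<Rightarrow> real"
  assumes "S \<in> sets lebesgue"
  shows "set_integrable lebesgue S f \<longleftrightarrow> integrable (lebesgue_on S) f"
  using assms by (simp add: set_integrable_def integrable_restrict_space)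

lemma integral_lebesgue_on_deriv:
  fixes F f :: "real \<Rightarrow> real"
  assumes "a \<le> b" "\<And>r. (F has_field_derivative f r) (at r)" "continuous_on {a..b} f"
  shows "integral\<^sup>L (lebesgue_on {a..b}) f = F b - F a"
proof -
  have "(f has_integral F b - F a) {a..b}"
    using assms by (intro fundamental_theorem_of_calculus)
      (auto simp: has_real_derivative_iff_has_vector_derivative[symmetric] intro: has_field_derivative_at_within)
  moreover have "integral\<^sup>L (lebesgue_on {a..b}) f = integral {a..b} f"
    using assms by (intro lebesgue_integral_eq_integral continuous_imp_integrable_real) auto
  ultimately show ?thesis by (simp add: integral_unique)
qed

lemma continuous_on_dominated_increments:
  fixes f H :: "real \<Rightarrow> real"
  assumes H: "continuous_on X H" and inc: "\<And>s t. \<lbrakk>s \<in> X; t \<in> X\<rbrakk> \<Longrightarrow> \<bar>f t - f s\<bar> \<le> L * \<bar>H t - H s\<bar>"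
  shows "continuous_on X f"
  unfolding continuous_on_def
proof
  fix x assume x: "x \<in> X"
  have "((\<lambda>y. L * \<bar>H y - H x\<bar>) \<longlongrightarrow> L * \<bar>H x - H x\<bar>) (at x within X)"
    using H x by (intro tendsto_intros) (auto simp: continuous_on_def)
  then have lim: "((\<lambda>y. L * \<bar>H y - H x\<bar>) \<longlongrightarrow> 0) (at x within X)" by simp
  have "\<forall>\<^sub>F y in at x within X. norm (f y - f x) \<le> L * \<bar>H y - H x\<bar>"
    unfolding eventually_at_filter using inc[OF x] by (intro always_eventually allI impI) simp
  then have "((\<lambda>y. f y - f x) \<longlongrightarrow> 0) (at x within X)"
    using lim by (rule Lim_null_comparison)
  then show "(f \<longlongrightarrow> f x) (at x within X)"
    by (simp add: LIM_zero_iff)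
qed

section \<open>Real inequalities behind the flow and the constants\<close>

text \<open>Here y is 1 + \<sigma> for the radius \<sigma> at the earlier time, and d is the
  increment of the integral of m. The lower bound, from exp d \<ge> 1 + d, has the rate 2 \<sigma>
  (1 + \<sigma>) that absorbs the flux; the upper bound, from exp (-d) \<ge> 1 - d, controls the
  remainder.\<close>

lemma exp_flow_increment:
  fixes y d Y :: real
  assumes "1 \<le> y" "0 \<le> d" "y * exp d \<le> Y"
  shows "2 * (y - 1) * y * d \<le> (y * exp d - 1)\<^sup>2 - (y - 1)\<^sup>2"
    and "(y * exp d - 1)\<^sup>2 - (y - 1)\<^sup>2 \<le> 2 * Y\<^sup>2 * d"
proof -
  have eq: "(y * exp d - 1)\<^sup>2 - (y - 1)\<^sup>2 = (y * exp d - y) * (y * exp d + y - 2)"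
    by (simp add: power2_eq_square algebra_simps)
  have "y * (1 + d) \<le> y * exp d"
    using assms by (intro mult_left_mono exp_ge_add_one_self) auto
  then have 1: "y * d \<le> y * exp d - y" by (simp add: algebra_simps)
  have "0 \<le> y * d" using assms by simp
  then have 2: "2 * (y - 1) \<le> y * exp d + y - 2" using 1 by simp
  have "(y * d) * (2 * (y - 1)) \<le> (y * exp d - y) * (y * exp d + y - 2)"
    using 1 2 assms \<open>0 \<le> y * d\<close> by (intro mult_mono) auto
  then show "2 * (y - 1) * y * d \<le> (y * exp d - 1)\<^sup>2 - (y - 1)\<^sup>2"
    unfolding eq by (simp add: mult_ac)
  have "1 - d \<le> exp (- d)" using exp_ge_add_one_self[of "- d"] by simp
  then have "y * exp d * (1 - d) \<le> y * exp d * exp (- d)"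
    using assms by (intro mult_left_mono) auto
  also have "y * exp d * exp (- d) = y" by (simp add: mult.assoc exp_minus_inverse)
  finally have "y * exp d - y \<le> y * exp d * d" by (simp add: algebra_simps)
  also have "\<dots> \<le> Y * d" using assms by (intro mult_right_mono)
  finally have 3: "y * exp d - y \<le> Y * d" .
  have "y \<le> y * exp d" using 1 \<open>0 \<le> y * d\<close> by simp
  then have 4: "y * exp d + y - 2 \<le> 2 * Y" using assms(3) by linarith
  have "(y * exp d - y) * (y * exp d + y - 2) \<le> (Y * d) * (2 * Y)"
  proof (rule mult_mono[OF 3 4])
    show "0 \<le> Y * d" using 1 3 \<open>0 \<le> y * d\<close> by linarith
    show "0 \<le> y * exp d + y - 2" by (rule order_trans[OF _ 2]) (use assms in simp)
  qed
  then show "(y * exp d - 1)\<^sup>2 - (y - 1)\<^sup>2 \<le> 2 * Y\<^sup>2 * d"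
    unfolding eq by (simp add: mult_ac power2_eq_square)
qed

lemma powr_convex_combination:
  fixes u w x y p :: real
  assumes "0 \<le> u" "0 \<le> w" "u + w = 1" "0 \<le> x" "0 \<le> y" "1 \<le> p"
  shows "(u * x + w * y) powr p \<le> u * x powr p + w * y powr p"
proof (cases "u * x + w * y = 0")
  case False
  define D where "D = u * x + w * y"
  have "0 < D" using False assms by (simp add: D_def less_le)
  define c where "c = p * D powr (p - 1)"
  have "u * (D powr p + c * (x - D)) + w * (D powr p + c * (y - D)) \<le> u * x powr p + w * y powr p"
    unfolding c_def using assms \<open>0 < D\<close>
    by (intro add_mono mult_left_mono powr_above_tangent) auto
  moreover have "u * (D powr p + c * (x - D)) + w * (D powr p + c * (y - D))
      = (u + w) * D powr p + c * (u * x + w * y - (u + w) * D)"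
    by (simp add: algebra_simps)
  ultimately show ?thesis
    using assms by (simp add: D_def)
qed (use assms in auto)

text \<open>With m the p-norm of f and N = \<alpha> m + \<beta>, the function \<alpha> f + \<beta>
  is N times the convex combination of f / m and 1 with weights \<alpha> m / N and \<beta> / N. Both
  have p-norm one, so convexity of the power gives N^p. The cases m = 0 and N = 0, where this
  divides by 0, are separate.\<close>

lemma (in prob_space) minkowski_const:
  fixes f :: "'a \<Rightarrow> real"
  assumes int: "integrable M (\<lambda>x. f x powr p)" and f[measurable]: "f \<in> borel_measurable M"
    and f_nonneg: "\<And>x. 0 \<le> f x" and p: "1 \<le> p" and \<alpha>: "0 \<le> \<alpha>" and \<beta>: "0 \<le> \<beta>"
  shows "(\<integral>\<^sup>+x. ennreal ((\<alpha> * f x + \<beta>) powr p) \<partial>M)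
    \<le> ennreal ((\<alpha> * (expectation (\<lambda>x. f x powr p)) powr (1 / p) + \<beta>) powr p)"
proof -
  define J where "J = expectation (\<lambda>x. f x powr p)"
  define m where "m = J powr (1 / p)"
  have "0 \<le> J" unfolding J_def by (intro integral_nonneg_AE) auto
  have mp: "m powr p = J" using p \<open>0 \<le> J\<close> by (simp add: m_def powr_powr)
  define N where "N = \<alpha> * m + \<beta>"
  have "0 \<le> m" by (simp add: m_def)
  show ?thesis
  proof (cases "J = 0")
    case True
    then have "AE x in M. f x powr p = 0"
      using integral_nonneg_eq_0_iff_AE[OF int] by (simp add: J_def)
    then have "AE x in M. ennreal ((\<alpha> * f x + \<beta>) powr p) = ennreal (\<beta> powr p)"
      by (rule eventually_mono) simp
    then have "(\<integral>\<^sup>+x. ennreal ((\<alpha> * f x + \<beta>) powr p) \<partial>M) = (\<integral>\<^sup>+x. ennreal (\<beta> powr p) \<partial>M)"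
      by (rule nn_integral_cong_AE)
    then show ?thesis
      using True p by (simp add: emeasure_space_1 J_def)
  next
    case False
    then have "0 < m" using \<open>0 \<le> J\<close> by (simp add: m_def)
    show ?thesis
    proof (cases "N = 0")
      case True
      then have "\<alpha> = 0" "\<beta> = 0" using \<open>0 < m\<close> \<alpha> \<beta> by (auto simp: N_def add_nonneg_eq_0_iff)
      then show ?thesis by simp
    next
      case False
      then have "0 < N" using \<alpha> \<beta> \<open>0 < m\<close> by (simp add: N_def less_le)
      define u where "u = \<alpha> * m / N"
      define w where "w = \<beta> / N"
      have uw: "0 \<le> u" "0 \<le> w" "u + w = 1"
        using \<open>0 < N\<close> \<open>0 < m\<close> \<alpha> \<beta> by (auto simp: u_def w_def N_def add_divide_distrib[symmetric])
      have pt: "(\<alpha> * f x + \<beta>) powr p \<le> N powr p * (u / J * f x powr p + w)" for x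
      proof -
        have "\<alpha> * f x + \<beta> = N * (u * (f x / m) + w * 1)"
          using \<open>0 < N\<close> \<open>0 < m\<close> by (simp add: u_def w_def field_simps)
        then have "(\<alpha> * f x + \<beta>) powr p = N powr p * (u * (f x / m) + w * 1) powr p"
          using \<open>0 < N\<close> by (simp add: powr_mult)
        also have "\<dots> \<le> N powr p * (u * (f x / m) powr p + w * 1 powr p)"
          using uw p f_nonneg[of x] \<open>0 < m\<close> by (intro mult_left_mono powr_convex_combination) auto
        also have "(f x / m) powr p = f x powr p / J"
          using f_nonneg[of x] \<open>0 < m\<close> by (simp add: powr_divide mp)
        finally show ?thesis by simp
      qed
      have int2: "integrable M (\<lambda>x. N powr p * (u / J * f x powr p + w))"
        using int by simp
      have "(\<integral>\<^sup>+x. ennreal ((\<alpha> * f x + \<beta>) powr p) \<partial>M) \<le> (\<integral>\<^sup>+x. ennreal (N powr p * (u / J * f x powr p + w)) \<partial>M)"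
        by (intro nn_integral_mono ennreal_leI pt)
      also have "\<dots> = ennreal (expectation (\<lambda>x. N powr p * (u / J * f x powr p + w)))"
        using order_trans[OF _ pt] by (intro nn_integral_eq_integral int2 AE_I2) auto
      also have "expectation (\<lambda>x. N powr p * (u / J * f x powr p + w)) = N powr p * (u / J * J + w)"
        using int by (simp add: J_def prob_space)
      also have "\<dots> = N powr p" using \<open>J \<noteq> 0\<close> uw by simp
      finally show ?thesis by (simp add: N_def m_def J_def)
    qed
  qed
qed

text \<open>The tangent of L^p is taken at 1/2 because there 2^(p-1) L^p / p has slope 1. This gives
  L \<le> (p-1)/p * 1/2 + 2^(p-1) L^p / p, and 1/2 \<le> ln 2 turns the constant term into the
  logarithm of the prefactor.\<close>

lemma exp_le_const_exp_powr:
  fixes L p :: real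
  assumes "1 \<le> p" "0 \<le> L"
  shows "exp L \<le> 2 powr ((p - 1) / p) * exp (2 powr (p - 1) / p * L powr p)"
proof -
  define k :: real where "k = 2 powr (p - 1)"
  have k: "0 < k" "(1/2) powr (p - 1) = 1 / k" "(1/2) powr p = 1 / (2 * k)"
    by (simp_all add: k_def powr_divide powr_diff)
  have "1 / (2 * k) + p * (1 / k) * (L - 1/2) \<le> L powr p"
    using powr_above_tangent[of p "1/2" L] assms by (simp add: k)
  then have "k / p * (1 / (2 * k) + p * (1 / k) * (L - 1/2)) \<le> k / p * L powr p"
    using k assms by (intro mult_left_mono) auto
  moreover have "k / p * (1 / (2 * k) + p * (1 / k) * (L - 1/2)) = L - (p - 1) / p * (1/2)"
    using k assms by (simp add: field_simps)
  moreover have "(p - 1) / p * (1/2) \<le> (p - 1) / p * ln 2"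
    using assms ln2_ge_two_thirds by (intro mult_left_mono) auto
  ultimately have "L \<le> (p - 1) / p * ln 2 + k / p * L powr p" by linarith
  then have "exp L \<le> exp ((p - 1) / p * ln 2 + k / p * L powr p)" by simp
  also have "\<dots> = 2 powr ((p - 1) / p) * exp (k / p * L powr p)"
    by (simp add: exp_add powr_def)
  finally show ?thesis by (simp add: k_def)
qed

section \<open>Evolution of radial means at a fixed radius\<close>

text \<open>The Wasserstein distance no longer appears: of absolute continuity only the effect on
  Lipschitz integrals is kept. The single function \<open>H\<close> dominates both their
  displacement and the integral of \<open>m\<close>, so all second-order errors are multiples of the
  square of one increment.\<close>

locale transported_curve = smooth_step S for S +
  fixes a b :: real and \<mu> :: "real \<Rightarrow> 'a::euclidean_space measure" and v :: "real \<Rightarrow> 'a \<Rightarrow> 'a"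
    and m H :: "real \<Rightarrow> real"
  assumes prob: "r \<in> {a..b} \<Longrightarrow> prob_space (\<mu> r)"
    and sets_borel: "r \<in> {a..b} \<Longrightarrow> sets (\<mu> r) = sets borel"
    and kantorovich: "\<lbrakk>L-lipschitz_on UNIV \<psi>; \<And>x. \<bar>\<psi> x\<bar> \<le> B; a \<le> s; s \<le> t; t \<le> b\<rbrakk> \<Longrightarrow>
      \<bar>(\<integral>x. \<psi> x \<partial>\<mu> t) - (\<integral>x. \<psi> x \<partial>\<mu> s)\<bar> \<le> L * (H t - H s)"
    and H_cont: "continuous_on {a..b} H"
    and H_mono: "mono_on {a..b} H"
    and v_meas: "(\<lambda>(t, x). v t x) \<in> borel_measurable (lebesgue_on {a..b} \<Otimes>\<^sub>M borel)"
    and m_int: "set_integrable lebesgue {a..b} m"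
    and m_nonneg: "r \<in> {a..b} \<Longrightarrow> 0 \<le> m r"
    and v_bound: "AE t in lebesgue_on {a..b}. AE x in \<mu> t. norm (v t x) \<le> m t * (1 + norm x)"
    and m_H: "\<lbrakk>a \<le> s; s \<le> t; t \<le> b\<rbrakk> \<Longrightarrow> (LINT r:{s..t}|lebesgue. m r) \<le> H t - H s"
    and equation: "continuity_equation a b v \<mu>"
begin

definition A :: "real \<Rightarrow> real" where
  "A t = (LINT r:{a..t}|lebesgue. m r)"

definition mean :: "(real \<Rightarrow> real) \<Rightarrow> real \<Rightarrow> real \<Rightarrow> real \<Rightarrow> real" where
  "mean D \<delta> \<sigma> r = (\<integral>x. radial D \<delta> \<sigma> x \<partial>\<mu> r)"

lemma A_diff: "\<lbrakk>a \<le> s; s \<le> t; t \<le> b\<rbrakk> \<Longrightarrow> A t - A s = (LINT r:{s..t}|lebesgue. m r)"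
  unfolding A_def by (rule set_integral_diff_interval[OF m_int, symmetric])

lemma A_mono:
  assumes "a \<le> s" "s \<le> t" "t \<le> b"
  shows "A s \<le> A t"
proof -
  have "0 \<le> (LINT r:{s..t}|lebesgue. m r)"
    unfolding set_lebesgue_integral_def
    using assms m_nonneg by (intro integral_nonneg_AE AE_I2) (auto simp: indicator_def)
  then show ?thesis using A_diff[OF assms] by simp
qed

lemma continuous_mean_lipschitz:
  assumes "L-lipschitz_on UNIV \<psi>" "\<And>x. \<bar>\<psi> x\<bar> \<le> B"
  shows "continuous_on {a..b} (\<lambda>r. \<integral>x. \<psi> x \<partial>\<mu> r :: real)"
proof (rule continuous_on_dominated_increments[OF H_cont])
  have *: "\<bar>(\<integral>x. \<psi> x \<partial>\<mu> t) - (\<integral>x. \<psi> x \<partial>\<mu> s)\<bar> \<le> L * \<bar>H t - H s\<bar>" if "a \<le> s" "s \<le> t" "t \<le> b" for s t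
    using kantorovich[OF assms that] mono_onD[OF H_mono, of s t] that by simp
  fix s t assume "s \<in> {a..b}" "t \<in> {a..b}"
  then show "\<bar>(\<integral>x. \<psi> x \<partial>\<mu> t) - (\<integral>x. \<psi> x \<partial>\<mu> s)\<bar> \<le> L * \<bar>H t - H s\<bar>"
    using *[of s t] *[of t s] by (cases "s \<le> t") (auto simp: abs_minus_commute)
qed

lemma kernel_measurable: "\<mu> \<in> measurable (lebesgue_on {a..b}) (subprob_algebra borel)"
  using prob sets_borel continuous_mean_lipschitz by (rule measurable_kernel_if_lipschitz_continuous)

lemma mean_increment:
  assumes "\<And>y. (D has_field_derivative D' y) (at y)" "\<And>y. \<bar>D y\<bar> \<le> B"
    "\<And>y. \<bar>D' y\<bar> \<le> M" "\<And>y. 1 \<le> y \<Longrightarrow> D' y = 0" "0 < \<delta>" "0 \<le> \<sigma>" "\<sigma> \<le> Y" "a \<le> s" "s \<le> t" "t \<le> b"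
  shows "\<bar>mean D \<delta> \<sigma> t - mean D \<delta> \<sigma> s\<bar> \<le> (2 * M * Y / \<delta>) * (H t - H s)"
  unfolding mean_def
  by (rule kantorovich[OF radial_lipschitz[OF assms(1,3-7)], of B])
     (use assms in \<open>auto simp: radial_def\<close>)

lemma radial_measurable [measurable]:
  "radial S \<delta> \<sigma> \<in> borel_measurable borel" "radial S' \<delta> \<sigma> \<in> borel_measurable borel"
proof -
  have "S \<in> borel_measurable borel" "S' \<in> borel_measurable borel"
    using continuous by (auto intro: borel_measurable_continuous_onI)
  then show "radial S \<delta> \<sigma> \<in> borel_measurable borel" "radial S' \<delta> \<sigma> \<in> borel_measurable borel"
    unfolding radial_def[abs_def] by measurable
qed

lemma mean_deriv_nonneg: "0 \<le> mean S' \<delta> \<sigma> r"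
  unfolding mean_def by (intro integral_nonneg_AE AE_I2) (simp add: radial_def deriv_nonneg)

lemma integrable_radial:
  assumes "r \<in> {a..b}"
  shows "integrable (\<mu> r) (radial S \<delta> \<sigma>)" "integrable (\<mu> r) (radial S' \<delta> \<sigma>)"
proof -
  interpret prob_space "\<mu> r" by (rule prob[OF assms])
  note [measurable_cong] = sets_borel[OF assms]
  obtain M where "\<forall>x. S' x \<le> M \<and> \<bar>S'' x\<bar> \<le> M" using deriv_bounded ..
  then show "integrable (\<mu> r) (radial S' \<delta> \<sigma>)"
    by (intro integrable_const_bound[where B = M]) (auto simp: radial_def deriv_nonneg)
  show "integrable (\<mu> r) (radial S \<delta> \<sigma>)"
    using bounds by (intro integrable_const_bound[where B = 1]) (auto simp: radial_def)
qed

text \<open>The pairing of \<open>v\<close> with the gradient of one minus the radial step, which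
  explains the sign: the mean of the step grows at the rate \<open>- flux\<close>.\<close>

definition flux :: "real \<Rightarrow> real \<Rightarrow> real \<Rightarrow> real" where
  "flux \<delta> \<sigma> r = (\<integral>x. - (radial S' \<delta> \<sigma> x * (2 / \<delta>) * (x \<bullet> v r x)) \<partial>\<mu> r)"

lemma flux_integrand_measurable [measurable]:
  "(\<lambda>(r, x). - (radial S' \<delta> \<sigma> x * (2 / \<delta>) * (x \<bullet> v r x))) \<in> borel_measurable (lebesgue_on {a..b} \<Otimes>\<^sub>M borel)"
proof -
  have "(\<lambda>z. v (fst z) (snd z)) \<in> borel_measurable (lebesgue_on {a..b} \<Otimes>\<^sub>M borel)"
    using v_meas by (simp add: case_prod_beta')
  then show ?thesis
    unfolding case_prod_beta' by (intro borel_measurable_uminus borel_measurable_times borel_measurable_inner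
      measurable_compose[OF measurable_snd] measurable_const) (auto intro: radial_measurable)
qed

lemma flux_measurable [measurable]: "flux \<delta> \<sigma> \<in> borel_measurable (lebesgue_on {a..b})"
  unfolding flux_def[abs_def] by (rule integral_kernel_measurable[OF flux_integrand_measurable kernel_measurable])

text \<open>On the layer |x| < \<sigma>, so |x \<bullet> v| \<le> \<sigma> m (1 + \<sigma>);
  elsewhere the derivative of the step vanishes. The mean of \<open>S'\<close> is kept on the right
  because the motion of the threshold will be measured by the same quantity.\<close>

lemma flux_bound:
  assumes "0 < \<delta>" "0 \<le> \<sigma>"
  shows "AE r in lebesgue_on {a..b}.
    integrable (\<mu> r) (\<lambda>x. - (radial S' \<delta> \<sigma> x * (2 / \<delta>) * (x \<bullet> v r x))) \<and>
    \<bar>flux \<delta> \<sigma> r\<bar> \<le> 2 * \<sigma> * (1 + \<sigma>) / \<delta> * m r * mean S' \<delta> \<sigma> r"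
proof (rule AE_mp[OF v_bound AE_I2], rule impI)
  fix r assume "r \<in> space (lebesgue_on {a..b})"
    and v_r: "AE x in \<mu> r. norm (v r x) \<le> m r * (1 + norm x)"
  then have r: "r \<in> {a..b}" by simp
  interpret prob_space "\<mu> r" by (rule prob[OF r])
  note [measurable_cong] = sets_borel[OF r]
  have "(\<lambda>x. - (radial S' \<delta> \<sigma> x * (2 / \<delta>) * (x \<bullet> v r x))) \<in> borel_measurable borel"
    using measurable_Pair2[OF flux_integrand_measurable, of r] r by simp
  then have [measurable]: "(\<lambda>x. - (radial S' \<delta> \<sigma> x * (2 / \<delta>) * (x \<bullet> v r x))) \<in> borel_measurable (\<mu> r)"
    by measurable
  have bd: "AE x in \<mu> r. norm (- (radial S' \<delta> \<sigma> x * (2 / \<delta>) * (x \<bullet> v r x)))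
      \<le> 2 * \<sigma> * (1 + \<sigma>) / \<delta> * m r * radial S' \<delta> \<sigma> x"
    using v_r
  proof eventually_elim
    case (elim x)
    show ?case
    proof (cases "\<sigma> \<le> norm x")
      case True
      then have "radial S' \<delta> \<sigma> x = 0"
        using assms deriv_eq_0 by (intro radial_eq_0_if_norm_gt) auto
      then show ?thesis by simp
    next
      case False
      have "\<bar>x \<bullet> v r x\<bar> \<le> norm x * norm (v r x)" by (rule Cauchy_Schwarz_ineq2)
      also have "\<dots> \<le> \<sigma> * (m r * (1 + \<sigma>))"
        using False assms m_nonneg[OF r] elim
        by (intro mult_mono order_trans[OF elim] mult_left_mono) auto
      finally have "radial S' \<delta> \<sigma> x * (2 / \<delta>) * \<bar>x \<bullet> v r x\<bar> \<le> radial S' \<delta> \<sigma> x * (2 / \<delta>) * (\<sigma> * (m r * (1 + \<sigma>)))"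
        using assms deriv_nonneg by (intro mult_left_mono) (auto simp: radial_def)
      then show ?thesis
        using assms deriv_nonneg by (simp add: abs_mult radial_def field_simps)
    qed
  qed
  have int: "integrable (\<mu> r) (\<lambda>x. 2 * \<sigma> * (1 + \<sigma>) / \<delta> * m r * radial S' \<delta> \<sigma> x)"
    using integrable_radial[OF r] by simp
  have int2: "integrable (\<mu> r) (\<lambda>x. - (radial S' \<delta> \<sigma> x * (2 / \<delta>) * (x \<bullet> v r x)))"
  proof (rule Bochner_Integration.integrable_bound[OF int])
    show "AE x in \<mu> r. norm (- (radial S' \<delta> \<sigma> x * (2 / \<delta>) * (x \<bullet> v r x)))
        \<le> norm (2 * \<sigma> * (1 + \<sigma>) / \<delta> * m r * radial S' \<delta> \<sigma> x)"
      using bd by (rule eventually_mono) (unfold real_norm_def, rule order_trans[OF _ abs_ge_self])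
  qed measurable
  moreover have "\<bar>flux \<delta> \<sigma> r\<bar> \<le> (\<integral>x. 2 * \<sigma> * (1 + \<sigma>) / \<delta> * m r * radial S' \<delta> \<sigma> x \<partial>\<mu> r)"
  proof -
    have "norm (flux \<delta> \<sigma> r) \<le> (\<integral>x. norm (- (radial S' \<delta> \<sigma> x * (2 / \<delta>) * (x \<bullet> v r x))) \<partial>\<mu> r)"
      unfolding flux_def by (rule integral_norm_bound)
    also have "\<dots> \<le> (\<integral>x. 2 * \<sigma> * (1 + \<sigma>) / \<delta> * m r * radial S' \<delta> \<sigma> x \<partial>\<mu> r)"
      by (rule integral_mono_AE[OF integrable_norm[OF int2] int bd])
    finally show ?thesis by simp
  qed
  ultimately show "integrable (\<mu> r) (\<lambda>x. - (radial S' \<delta> \<sigma> x * (2 / \<delta>) * (x \<bullet> v r x))) \<and>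
      \<bar>flux \<delta> \<sigma> r\<bar> \<le> 2 * \<sigma> * (1 + \<sigma>) / \<delta> * m r * mean S' \<delta> \<sigma> r"
    by (simp add: mean_def)
qed

text \<open>The inner integral splits into its two terms only where the flux integrand is
  integrable, hence for almost every time. Comparing the time integrals then requires both sides to
  be measurable, which is where the kernel property of \<mu> is used.\<close>

lemma equation_integral_zero:
  assumes "0 < \<delta>" "0 \<le> \<sigma>" "0 < e" "a \<le> s" "s + 3 * e \<le> t" "t \<le> b"
  shows "(\<integral>r. (S' ((r - s) / e - 1) / e - S' ((r - t) / e + 2) / e) * (1 - mean S \<delta> \<sigma> r)
      + time_cutoff S e s t r * flux \<delta> \<sigma> r \<partial>lebesgue_on {a..b}) = 0"
proof -
  define \<phi> where "\<phi> z = time_cutoff S e s t (fst z) * (1 - radial S \<delta> \<sigma> (snd z))" for z :: "real \<times> 'a"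
  define \<eta>' where "\<eta>' r = S' ((r - s) / e - 1) / e - S' ((r - t) / e + 2) / e" for r
  define g where "g r x = - (radial S' \<delta> \<sigma> x * (2 / \<delta>) * (x \<bullet> v r x))" for r and x :: 'a
  define J where "J r = (\<integral>x. \<eta>' r * (1 - radial S \<delta> \<sigma> x) + time_cutoff S e s t r * g r x \<partial>\<mu> r)" for r
  have \<phi>: "\<phi> \<in> test_functions ({a<..<b} \<times> UNIV)"
    unfolding \<phi>_def[abs_def] by (rule cutoff_test_function) (use assms in auto)
  have "deriv (\<lambda>q. \<phi> (q, x)) r = \<eta>' r * (1 - radial S \<delta> \<sigma> x)" for r x
    unfolding \<phi>_def \<eta>'_def fst_conv snd_conv
    by (intro DERIV_imp_deriv DERIV_cmult_right time_cutoff_has_deriv assms)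
  moreover have "gradient (\<lambda>y. \<phi> (r, y)) x \<bullet> v r x = time_cutoff S e s t r * g r x" for r x
  proof -
    have "((\<lambda>y. \<phi> (r, y)) has_derivative
        (\<lambda>h. (- (time_cutoff S e s t r * (radial S' \<delta> \<sigma> x * (2 / \<delta>)))) *\<^sub>R x \<bullet> h)) (at x)"
      unfolding \<phi>_def fst_conv snd_conv
      using radial_has_derivative[OF has_deriv, of \<delta> \<sigma> x] assms(1)
      by (auto intro!: derivative_eq_intros)
    from gradient_eqI[OF this] show ?thesis by (simp add: g_def)
  qed
  ultimately have "(LINT r:{a..b}|lebesgue. J r) = 0"
    using bspec[OF equation[unfolded continuity_equation_def] \<phi>] by (simp add: J_def)
  then have "(\<integral>r. J r \<partial>lebesgue_on {a..b}) = 0"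
    by (simp add: set_integral_eq_lebesgue_on)
  moreover have "(\<integral>r. J r \<partial>lebesgue_on {a..b}) =
      (\<integral>r. \<eta>' r * (1 - mean S \<delta> \<sigma> r) + time_cutoff S e s t r * flux \<delta> \<sigma> r \<partial>lebesgue_on {a..b})"
  proof (rule integral_cong_AE)
    have cont: "continuous_on UNIV \<eta>'" "continuous_on UNIV (time_cutoff S e s t)"
      unfolding \<eta>'_def[abs_def] time_cutoff_def[abs_def] using assms(3)
      by (auto intro!: continuous_intros continuous[THEN continuous_on_compose2])
    have [measurable]: "\<eta>' \<in> borel_measurable (lebesgue_on {a..b})"
      "time_cutoff S e s t \<in> borel_measurable (lebesgue_on {a..b})"
      using cont by (auto intro!: continuous_imp_measurable_on_sets_lebesgue intro: continuous_on_subset)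
    have gm: "(\<lambda>z. g (fst z) (snd z)) \<in> borel_measurable (lebesgue_on {a..b} \<Otimes>\<^sub>M borel)"
      using flux_integrand_measurable by (simp add: g_def case_prod_beta')
    have "(\<lambda>z. \<eta>' (fst z) * (1 - radial S \<delta> \<sigma> (snd z)) + time_cutoff S e s t (fst z) * g (fst z) (snd z))
        \<in> borel_measurable (lebesgue_on {a..b} \<Otimes>\<^sub>M borel)"
      using gm by measurable
    then show "J \<in> borel_measurable (lebesgue_on {a..b})"
      unfolding J_def[abs_def]
      by (intro integral_kernel_measurable[OF _ kernel_measurable]) (simp add: case_prod_beta')
    have "(\<lambda>r. \<integral>x. radial S \<delta> \<sigma> x \<partial>\<mu> r) \<in> borel_measurable (lebesgue_on {a..b})"
      by (intro integral_kernel_measurable[OF _ kernel_measurable]) measurable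
    then have [measurable]: "mean S \<delta> \<sigma> \<in> borel_measurable (lebesgue_on {a..b})"
      by (simp add: mean_def[abs_def])
    show "(\<lambda>r. \<eta>' r * (1 - mean S \<delta> \<sigma> r) + time_cutoff S e s t r * flux \<delta> \<sigma> r)
        \<in> borel_measurable (lebesgue_on {a..b})"
      by measurable
    show "AE r in lebesgue_on {a..b}. J r = \<eta>' r * (1 - mean S \<delta> \<sigma> r) + time_cutoff S e s t r * flux \<delta> \<sigma> r"
    proof (rule AE_mp[OF flux_bound[OF assms(1,2)] AE_I2], rule impI)
      fix r assume "r \<in> space (lebesgue_on {a..b})"
        and *: "integrable (\<mu> r) (\<lambda>x. - (radial S' \<delta> \<sigma> x * (2 / \<delta>) * (x \<bullet> v r x))) \<and>
          \<bar>flux \<delta> \<sigma> r\<bar> \<le> 2 * \<sigma> * (1 + \<sigma>) / \<delta> * m r * mean S' \<delta> \<sigma> r"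
      then have r: "r \<in> {a..b}" by simp
      interpret prob_space "\<mu> r" by (rule prob[OF r])
      have "integrable (\<mu> r) (g r)" using * by (simp add: g_def[abs_def])
      then have "J r = \<eta>' r * (\<integral>x. 1 - radial S \<delta> \<sigma> x \<partial>\<mu> r) + time_cutoff S e s t r * (\<integral>x. g r x \<partial>\<mu> r)"
        unfolding J_def using integrable_radial(1)[OF r] by (subst Bochner_Integration.integral_add) auto
      also have "(\<integral>x. 1 - radial S \<delta> \<sigma> x \<partial>\<mu> r) = 1 - mean S \<delta> \<sigma> r"
        unfolding mean_def using integrable_radial(1)[OF r] by (subst Bochner_Integration.integral_diff) (auto simp: prob_space)
      finally show "J r = \<eta>' r * (1 - mean S \<delta> \<sigma> r) + time_cutoff S e s t r * flux \<delta> \<sigma> r"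
        by (simp add: flux_def g_def)
    qed
  qed
  ultimately show ?thesis by (simp add: \<eta>'_def)
qed

lemma mean_continuous:
  assumes "0 < \<delta>" "0 \<le> \<sigma>"
  shows "continuous_on {a..b} (mean S \<delta> \<sigma>)"
proof -
  obtain M where M: "\<forall>x. S' x \<le> M \<and> \<bar>S'' x\<bar> \<le> M" using deriv_bounded ..
  then have "\<bar>S' x\<bar> \<le> M" for x by (simp add: deriv_nonneg)
  then have "(2 * M * \<sigma> / \<delta>)-lipschitz_on UNIV (radial S \<delta> \<sigma> :: 'a \<Rightarrow> real)"
    by (rule radial_lipschitz[OF has_deriv]) (use assms deriv_eq_0 in auto)
  from continuous_mean_lipschitz[OF this, of 1] show ?thesis
    using bounds by (simp add: mean_def[abs_def] radial_def[abs_def])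
qed

text \<open>Testing the equation with a time cut-off that tends to the indicator function of \<open>[s, t]\<close>.\<close>

lemma mean_growth_cutoff:
  assumes \<delta>: "0 < \<delta>" and \<sigma>: "0 \<le> \<sigma>" and e: "0 < e" "a \<le> s" "s + 4 * e \<le> t" "t \<le> b"
    and L: "0 \<le> L" "\<And>r q. \<lbrakk>a \<le> r; r \<le> q; q \<le> b\<rbrakk> \<Longrightarrow> \<bar>mean S \<delta> \<sigma> q - mean S \<delta> \<sigma> r\<bar> \<le> L * (H q - H r)"
    and \<kappa>: "\<And>r. r \<in> {s..t} \<Longrightarrow> mean S' \<delta> \<sigma> r \<le> \<kappa>"
  shows "(mean S \<delta> \<sigma> t - L * (H t - H (t - 2 * e))) - (mean S \<delta> \<sigma> s + L * (H (s + 2 * e) - H s))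
    \<le> (A t - A s) * (2 * \<sigma> * (1 + \<sigma>) / \<delta>) * \<kappa>"
proof -
  let ?M = "lebesgue_on {a..b}"
  define c where "c = 2 * \<sigma> * (1 + \<sigma>) / \<delta>"
  have "0 \<le> c" using \<delta> \<sigma> by (simp add: c_def)
  have "0 \<le> \<kappa>" using \<kappa>[of s] mean_deriv_nonneg[of \<delta> \<sigma> s] e by simp
  \<comment> \<open>The two parts of the derivative of the time cut-off: probability densities
    carried by [s + e, s + 2 e] and [t - 2 e, t - e]. Averaging against them approximates evaluation
    at s and at t.\<close>
  define \<theta>1 where "\<theta>1 r = S' ((r - s) / e - 1) / e" for r
  define \<theta>2 where "\<theta>2 r = S' ((r - t) / e + 2) / e" for r
  define E where "E = mean S \<delta> \<sigma>"
  define \<eta> where "\<eta> = time_cutoff S e s t"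
  have cont: "continuous_on X \<theta>1" "continuous_on X \<theta>2" "continuous_on X \<eta>" for X
    unfolding \<theta>1_def[abs_def] \<theta>2_def[abs_def] \<eta>_def time_cutoff_def[abs_def] using e
    by (auto intro!: continuous_intros continuous[THEN continuous_on_compose2])
  have E_cont: "continuous_on {a..b} E"
    using mean_continuous[OF \<delta> \<sigma>] by (simp add: E_def)
  have int: "integrable ?M \<theta>1" "integrable ?M \<theta>2" "integrable ?M (\<lambda>r. \<theta>1 r * E r)" "integrable ?M (\<lambda>r. \<theta>2 r * E r)"
    using E_cont by (auto intro!: continuous_imp_integrable_real continuous_on_mult cont)
  have m: "integrable ?M m"
    using m_int by (simp add: set_integrable_iff_lebesgue_on)
  have \<eta>_range: "0 \<le> \<eta> r" "\<eta> r \<le> 1" and \<eta>_zero: "\<not> (s \<le> r \<and> r \<le> t) \<Longrightarrow> \<eta> r = 0" for r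
    using time_cutoff_bounds[of e s t r] e by (auto simp: \<eta>_def)
  have flux_le: "AE r in ?M. \<bar>\<eta> r * flux \<delta> \<sigma> r\<bar> \<le> indicator {s..t} r * (c * \<kappa> * m r)"
  proof (rule AE_mp[OF flux_bound[OF \<delta> \<sigma>] AE_I2], rule impI)
    fix r assume "r \<in> space ?M" and *: "integrable (\<mu> r) (\<lambda>x. - (radial S' \<delta> \<sigma> x * (2 / \<delta>) * (x \<bullet> v r x))) \<and>
          \<bar>flux \<delta> \<sigma> r\<bar> \<le> 2 * \<sigma> * (1 + \<sigma>) / \<delta> * m r * mean S' \<delta> \<sigma> r"
    then have r: "r \<in> {a..b}" by simp
    show "\<bar>\<eta> r * flux \<delta> \<sigma> r\<bar> \<le> indicator {s..t} r * (c * \<kappa> * m r)"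
    proof (cases "r \<in> {s..t}")
      case True
      have "\<bar>\<eta> r * flux \<delta> \<sigma> r\<bar> \<le> 1 * \<bar>flux \<delta> \<sigma> r\<bar>"
        unfolding abs_mult using \<eta>_range by (intro mult_right_mono) auto
      also have "\<dots> \<le> c * m r * mean S' \<delta> \<sigma> r" using * by (simp add: c_def)
      also have "\<dots> \<le> c * m r * \<kappa>"
        using \<kappa>[OF True] \<open>0 \<le> c\<close> m_nonneg[OF r] by (intro mult_left_mono) auto
      finally show ?thesis using True by (simp add: mult_ac)
    next
      case False
      then show ?thesis using \<eta>_zero[of r] by auto
    qed
  qed
  have [measurable]: "\<eta> \<in> borel_measurable ?M"
    by (rule continuous_imp_measurable_on_sets_lebesgue[OF cont(3)]) simp
  have int_ind: "integrable ?M (\<lambda>r. indicator {s..t} r * (c * \<kappa> * m r))"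
    using integrable_mult_indicator[of "{s..t}" ?M "\<lambda>r. c * \<kappa> * m r"] m e
    by (simp add: sets_restrict_space_iff)
  have int_flux: "integrable ?M (\<lambda>r. \<eta> r * flux \<delta> \<sigma> r)"
  proof (rule Bochner_Integration.integrable_bound[OF int_ind])
    show "AE r in ?M. norm (\<eta> r * flux \<delta> \<sigma> r) \<le> norm (indicator {s..t} r * (c * \<kappa> * m r))"
      using flux_le by (rule eventually_mono) (unfold real_norm_def, rule order_trans[OF _ abs_ge_self])
  qed measurable
  have "- (\<integral>r. \<eta> r * flux \<delta> \<sigma> r \<partial>?M) \<le> (\<integral>r. indicator {s..t} r * (c * \<kappa> * m r) \<partial>?M)"
  proof -
    have "- (\<integral>r. \<eta> r * flux \<delta> \<sigma> r \<partial>?M) = (\<integral>r. - (\<eta> r * flux \<delta> \<sigma> r) \<partial>?M)" by simp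
    also have "\<dots> \<le> (\<integral>r. indicator {s..t} r * (c * \<kappa> * m r) \<partial>?M)"
      using flux_le by (intro integral_mono_AE Bochner_Integration.integrable_minus int_flux int_ind)
        (auto elim!: eventually_mono)
    finally show ?thesis .
  qed
  also have "\<dots> = c * \<kappa> * (A t - A s)"
  proof -
    have "(\<integral>r. indicator {s..t} r * (c * \<kappa> * m r) \<partial>?M) = c * \<kappa> * (\<integral>r. indicator {s..t} r * m r \<partial>?M)"
      by (subst integral_mult_right_zero[symmetric]) (simp add: mult_ac)
    also have "(\<integral>r. indicator {s..t} r * m r \<partial>?M) = (\<integral>r. indicator {a..b} r * (indicator {s..t} r * m r) \<partial>lebesgue)"
      by (simp add: integral_restrict_space)
    also have "\<dots> = (LINT r:{s..t}|lebesgue. m r)"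
      unfolding set_lebesgue_integral_def using e
      by (intro Bochner_Integration.integral_cong) (auto simp: indicator_def)
    finally show ?thesis using A_diff[of s t] e by simp
  qed
  finally have upper: "- (\<integral>r. \<eta> r * flux \<delta> \<sigma> r \<partial>?M) \<le> c * \<kappa> * (A t - A s)" .
  have \<theta>_nonneg: "0 \<le> \<theta>1 r" "0 \<le> \<theta>2 r" for r
    using e deriv_nonneg by (auto simp: \<theta>1_def \<theta>2_def)
  have I1: "(\<integral>r. \<theta>1 r \<partial>?M) = 1"
  proof -
    have "(\<integral>r. \<theta>1 r \<partial>?M) = S ((b - s) / e - 1) - S ((a - s) / e - 1)"
      using e by (intro integral_lebesgue_on_deriv[of a b "\<lambda>r. S ((r - s) / e - 1)"] cont)
        (use affine_has_deriv[of e s "- 1"] in \<open>auto simp: \<theta>1_def\<close>)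
    moreover have "1 \<le> (b - s) / e - 1" "(a - s) / e - 1 \<le> 0" using e by (auto simp: field_simps)
    ultimately show ?thesis by (simp add: zero one)
  qed
  have I2: "(\<integral>r. \<theta>2 r \<partial>?M) = 1"
  proof -
    have "(\<integral>r. \<theta>2 r \<partial>?M) = S ((b - t) / e + 2) - S ((a - t) / e + 2)"
      using e by (intro integral_lebesgue_on_deriv[of a b "\<lambda>r. S ((r - t) / e + 2)"] cont)
        (use affine_has_deriv[of e t "2"] in \<open>auto simp: \<theta>2_def\<close>)
    moreover have "1 \<le> (b - t) / e + 2" "(a - t) / e + 2 \<le> 0" using e by (auto simp: field_simps)
    ultimately show ?thesis by (simp add: zero one)
  qed
  have "(\<integral>r. \<theta>1 r * E r \<partial>?M) \<le> (\<integral>r. \<theta>1 r * (E s + L * (H (s + 2 * e) - H s)) \<partial>?M)"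
  proof (rule integral_mono)
    fix r assume "r \<in> space ?M"
    then have r: "r \<in> {a..b}" by simp
    show "\<theta>1 r * E r \<le> \<theta>1 r * (E s + L * (H (s + 2 * e) - H s))"
    proof (cases "s \<le> r \<and> r \<le> s + 2 * e")
      case True
      have "H r \<le> H (s + 2 * e)" using True e r by (intro mono_onD[OF H_mono]) auto
      then have "E r \<le> E s + L * (H (s + 2 * e) - H s)"
        using L(2)[of s r] mult_left_mono[of "H r - H s" "H (s + 2 * e) - H s" L] L(1) True e r
        by (simp add: E_def)
      then show ?thesis using \<theta>_nonneg by (intro mult_left_mono)
    next
      case False
      then have "(r - s) / e - 1 \<le> 0 \<or> 1 \<le> (r - s) / e - 1" using e by (auto simp: field_simps)
      then show ?thesis by (auto simp: \<theta>1_def deriv_eq_0)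
    qed
  qed (use int in auto)
  then have 1: "(\<integral>r. \<theta>1 r * E r \<partial>?M) \<le> E s + L * (H (s + 2 * e) - H s)"
    by (simp add: I1)
  have "(\<integral>r. \<theta>2 r * (E t - L * (H t - H (t - 2 * e))) \<partial>?M) \<le> (\<integral>r. \<theta>2 r * E r \<partial>?M)"
  proof (rule integral_mono)
    fix r assume "r \<in> space ?M"
    then have r: "r \<in> {a..b}" by simp
    show "\<theta>2 r * (E t - L * (H t - H (t - 2 * e))) \<le> \<theta>2 r * E r"
    proof (cases "t - 2 * e \<le> r \<and> r \<le> t")
      case True
      have "H (t - 2 * e) \<le> H r" using True e r by (intro mono_onD[OF H_mono]) auto
      then have "E t - L * (H t - H (t - 2 * e)) \<le> E r"
        using L(2)[of r t] mult_left_mono[of "H t - H r" "H t - H (t - 2 * e)" L] L(1) True e r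
        by (simp add: E_def)
      then show ?thesis using \<theta>_nonneg by (intro mult_left_mono)
    next
      case False
      then have "(r - t) / e + 2 \<le> 0 \<or> 1 \<le> (r - t) / e + 2" using e by (auto simp: field_simps)
      then show ?thesis by (auto simp: \<theta>2_def deriv_eq_0)
    qed
  qed (use int in auto)
  then have 2: "E t - L * (H t - H (t - 2 * e)) \<le> (\<integral>r. \<theta>2 r * E r \<partial>?M)"
    by (simp add: I2)
  have "0 = (\<integral>r. (\<theta>1 r - \<theta>2 r) * (1 - E r) + \<eta> r * flux \<delta> \<sigma> r \<partial>?M)"
    using equation_integral_zero[OF \<delta> \<sigma> e(1,2) _ e(4)] e
    by (simp add: \<theta>1_def \<theta>2_def E_def \<eta>_def)
  also have "\<dots> = (\<integral>r. \<theta>1 r - \<theta>2 r - \<theta>1 r * E r + \<theta>2 r * E r + \<eta> r * flux \<delta> \<sigma> r \<partial>?M)"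
    by (intro Bochner_Integration.integral_cong) (auto simp: algebra_simps)
  \<comment> \<open>Both densities have mass one, so the total mass contributed by
    \<open>1 - E\<close> cancels.\<close>
  also have "\<dots> = 1 - 1 - (\<integral>r. \<theta>1 r * E r \<partial>?M) + (\<integral>r. \<theta>2 r * E r \<partial>?M) + (\<integral>r. \<eta> r * flux \<delta> \<sigma> r \<partial>?M)"
    using int int_flux by (simp add: I1 I2)
  finally show ?thesis
    using upper 1 2 by (simp add: E_def c_def mult_ac)
qed

text \<open>The errors in \<open>mean_growth_cutoff\<close> are increments of \<open>H\<close> over
  intervals of length \<open>2 * e\<close>, which vanish with \<open>e\<close> by continuity of
  \<open>H\<close>.\<close>

lemma mean_growth:
  assumes \<delta>: "0 < \<delta>" and \<sigma>: "0 \<le> \<sigma>" and st: "a \<le> s" "s \<le> t" "t \<le> b"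
    and \<kappa>: "\<And>r. r \<in> {s..t} \<Longrightarrow> mean S' \<delta> \<sigma> r \<le> \<kappa>"
  shows "mean S \<delta> \<sigma> t - mean S \<delta> \<sigma> s \<le> (A t - A s) * (2 * \<sigma> * (1 + \<sigma>) / \<delta>) * \<kappa>"
proof (cases "s = t")
  case False
  with st have "s < t" by simp
  obtain M where M: "\<forall>x. S' x \<le> M \<and> \<bar>S'' x\<bar> \<le> M" using deriv_bounded ..
  then have M': "\<bar>S' x\<bar> \<le> M" for x by (simp add: deriv_nonneg)
  define L where "L = 2 * M * \<sigma> / \<delta>"
  have "0 \<le> L" using M'[of 0] \<delta> \<sigma> by (simp add: L_def)
  have L: "\<bar>mean S \<delta> \<sigma> q - mean S \<delta> \<sigma> r\<bar> \<le> L * (H q - H r)" if "a \<le> r" "r \<le> q" "q \<le> b" for r q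
    unfolding L_def
    by (rule mean_increment[OF has_deriv _ M', of 1]) (use bounds deriv_eq_0 that \<delta> \<sigma> in auto)
  define e where "e n = (t - s) / 4 * inverse (real (Suc n))" for n
  have e: "0 < e n" "s + 4 * e n \<le> t" for n
  proof -
    show "0 < e n" using \<open>s < t\<close> by (simp add: e_def)
    have "(t - s) * inverse (real (Suc n)) \<le> (t - s) * 1"
      using \<open>s < t\<close> by (intro mult_left_mono) (auto simp: inverse_le_1_iff)
    then show "s + 4 * e n \<le> t" by (simp add: e_def)
  qed
  have "e \<longlonglongrightarrow> (t - s) / 4 * 0"
    unfolding e_def[abs_def] by (intro tendsto_intros LIMSEQ_inverse_real_of_nat)
  then have e0: "e \<longlonglongrightarrow> 0" by simp
  have H1: "(\<lambda>n. H (t - 2 * e n)) \<longlonglongrightarrow> H t"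
  proof (rule continuous_on_tendsto_compose[OF H_cont])
    show "(\<lambda>n. t - 2 * e n) \<longlonglongrightarrow> t" using tendsto_diff[OF tendsto_const tendsto_mult_left[OF e0], of t 2] by simp
    have "t - 2 * e n \<in> {a..b}" for n using e[of n] st by auto
    then show "\<forall>\<^sub>F n in sequentially. t - 2 * e n \<in> {a..b}" by simp
  qed (use st in auto)
  have H2: "(\<lambda>n. H (s + 2 * e n)) \<longlonglongrightarrow> H s"
  proof (rule continuous_on_tendsto_compose[OF H_cont])
    show "(\<lambda>n. s + 2 * e n) \<longlonglongrightarrow> s" using tendsto_add[OF tendsto_const tendsto_mult_left[OF e0], of s 2] by simp
    have "s + 2 * e n \<in> {a..b}" for n using e[of n] st by auto
    then show "\<forall>\<^sub>F n in sequentially. s + 2 * e n \<in> {a..b}" by simp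
  qed (use st in auto)
  have "(\<lambda>n. (mean S \<delta> \<sigma> t - L * (H t - H (t - 2 * e n))) - (mean S \<delta> \<sigma> s + L * (H (s + 2 * e n) - H s)))
      \<longlonglongrightarrow> (mean S \<delta> \<sigma> t - L * (H t - H t)) - (mean S \<delta> \<sigma> s + L * (H s - H s))"
    by (intro tendsto_intros H1 H2)
  then show ?thesis
    using mean_growth_cutoff[OF \<delta> \<sigma> e(1) st(1) e(2) st(3) \<open>0 \<le> L\<close> L \<kappa>]
    by (intro LIMSEQ_le_const2) auto
qed simp

text \<open>At a fixed time, enlarging the radius shifts the argument of the step by
  \<open>d\<close> at every point x, so \<open>shift_le\<close> can be integrated.\<close>

lemma mean_larger_radius_le:
  assumes M: "\<And>x. \<bar>S'' x\<bar> \<le> M" and r: "r \<in> {a..b}" and \<delta>: "0 < \<delta>" and d: "d = (\<sigma>'\<^sup>2 - \<sigma>\<^sup>2) / \<delta>" "0 \<le> d"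
  shows "mean S \<delta> \<sigma>' r \<le> mean S \<delta> \<sigma> r - d * mean S' \<delta> \<sigma> r + M * d\<^sup>2"
proof -
  interpret prob_space "\<mu> r" by (rule prob[OF r])
  have "mean S \<delta> \<sigma>' r \<le> (\<integral>x. radial S \<delta> \<sigma> x - d * radial S' \<delta> \<sigma> x + M * d\<^sup>2 \<partial>\<mu> r)"
    unfolding mean_def
  proof (rule integral_mono)
    fix x :: 'a
    have eq: "(x \<bullet> x - \<sigma>'\<^sup>2) / \<delta> + 1 = ((x \<bullet> x - \<sigma>\<^sup>2) / \<delta> + 1) - d"
      using \<delta> by (simp add: d(1) field_simps)
    show "radial S \<delta> \<sigma>' x \<le> radial S \<delta> \<sigma> x - d * radial S' \<delta> \<sigma> x + M * d\<^sup>2"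
      unfolding radial_def eq by (rule shift_le[OF M d(2)])
  qed (use integrable_radial[OF r] in auto)
  also have "\<dots> = mean S \<delta> \<sigma> r - d * mean S' \<delta> \<sigma> r + M * d\<^sup>2"
    using integrable_radial[OF r] by (simp add: mean_def prob_space)
  finally show ?thesis .
qed

section \<open>Moving the threshold along the flow\<close>

definition flow :: "real \<Rightarrow> real \<Rightarrow> real" where
  "flow \<rho> t = exp (A t) * (1 + \<rho>) - 1"

lemma A_start: "A a = 0"
proof -
  have "AE r in lebesgue. indicator {a..a} r * m r = 0"
    by (rule AE_I'[of "{a}"]) (auto simp: indicator_def)
  then show ?thesis
    unfolding A_def set_lebesgue_integral_def by (simp add: integral_eq_zero_AE)
qed

lemma A_le_H: "\<lbrakk>a \<le> s; s \<le> t; t \<le> b\<rbrakk> \<Longrightarrow> A t - A s \<le> H t - H s"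
  using A_diff m_H by simp

text \<open>To first order in \<open>t - s\<close>, the mass gained through the transport (\<open>mean_growth\<close>) is at most the
  mass lost by moving the threshold along \<open>flow \<rho>\<close>, whose square grows at least at the rate
  \<open>2 \<sigma> (1 + \<sigma>) m\<close> occurring there; the errors are quadratic in the increment of \<open>H\<close>.\<close>

lemma mean_along_flow_increment:
  assumes \<delta>: "0 < \<delta>" and \<rho>: "0 \<le> \<rho>"
  obtains C where "\<And>s t. \<lbrakk>a \<le> s; s \<le> t; t \<le> b\<rbrakk> \<Longrightarrow>
    mean S \<delta> (flow \<rho> t) t - mean S \<delta> (flow \<rho> s) s \<le> C * (H t - H s)\<^sup>2"
proof -
  obtain M where "\<forall>x. S' x \<le> M \<and> \<bar>S'' x\<bar> \<le> M" using deriv_bounded ..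
  then have M: "\<bar>S'' x\<bar> \<le> M" "\<bar>S' x\<bar> \<le> M" for x by (auto simp: deriv_nonneg)
  then have "0 \<le> M" using abs_ge_zero order_trans by blast
  \<comment> \<open>\<open>Y\<close> bounds 1 + \<sigma> along the whole flow, \<open>L\<close> is
    the constant in the modulus of the mean of \<open>S'\<close> for all radii up to
    \<open>Y\<close>, and \<open>W\<close> converts increments of \<open>A\<close> into shifts of
    the argument of the step.\<close>
  define Y where "Y = exp (A b) * (1 + \<rho>)"
  define L where "L = 2 * M * Y / \<delta>"
  define W where "W = 2 * Y\<^sup>2 / \<delta>"
  have nonneg: "0 \<le> Y" "0 \<le> L" "0 \<le> W" using \<rho> \<delta> \<open>0 \<le> M\<close> by (auto simp: Y_def L_def W_def)
  show thesis
  proof (rule that[of "2 * W * L + M * W\<^sup>2"])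
    fix s t assume st: "a \<le> s" "s \<le> t" "t \<le> b"
    define \<sigma> where "\<sigma> = flow \<rho> s"
    define y where "y = exp (A s) * (1 + \<rho>)"
    define dA where "dA = A t - A s"
    define dH where "dH = H t - H s"
    define K where "K = mean S' \<delta> \<sigma> s"
    \<comment> \<open>\<open>x\<close> multiplies the mean of \<open>S'\<close> in the gain by
      transport, \<open>z\<close> multiplies it in the loss by the moving threshold; the inequality
      \<open>x \<le> z\<close> is the cancellation.\<close>
    define x where "x = dA * (2 * \<sigma> * (1 + \<sigma>) / \<delta>)"
    define z where "z = ((flow \<rho> t)\<^sup>2 - \<sigma>\<^sup>2) / \<delta>"
    have A: "0 \<le> A s" "0 \<le> dA" "dA \<le> dH" "A t \<le> A b"
      using A_mono[of a s] A_mono[of s t] A_mono[of t b] A_start A_le_H[OF st] st by (auto simp: dA_def dH_def)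
    have "1 * 1 \<le> exp (A s) * (1 + \<rho>)" using A \<rho> by (intro mult_mono) auto
    then have "1 \<le> y" by (simp add: y_def)
    have \<sigma>: "\<sigma> = y - 1" by (simp add: \<sigma>_def flow_def y_def)
    have "exp (A t) = exp (A s) * exp dA" by (simp add: dA_def flip: exp_add)
    then have flow_t: "flow \<rho> t = y * exp dA - 1" "y * exp dA = exp (A t) * (1 + \<rho>)"
      by (simp_all add: flow_def y_def)
    have "y * exp dA \<le> Y"
      unfolding flow_t Y_def using A \<rho> by (intro mult_right_mono) auto
    then have incr: "2 * (y - 1) * y * dA \<le> (flow \<rho> t)\<^sup>2 - \<sigma>\<^sup>2" "(flow \<rho> t)\<^sup>2 - \<sigma>\<^sup>2 \<le> 2 * Y\<^sup>2 * dA"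
      unfolding flow_t(1) \<sigma> using \<open>1 \<le> y\<close> A by (intro exp_flow_increment; simp)+
    have xz: "x \<le> z" "z \<le> W * dA"
      using divide_right_mono[OF incr(1), of \<delta>] divide_right_mono[OF incr(2), of \<delta>] \<delta>
      by (simp_all add: x_def z_def W_def \<sigma> mult_ac)
    have "W * dA \<le> W * dH" using A nonneg by (intro mult_left_mono)
    then have zW: "z \<le> W * dH" using xz by simp
    have "0 \<le> x" using A \<sigma> \<open>1 \<le> y\<close> \<delta> by (simp add: x_def)
    then have "0 \<le> z" using xz by simp
    have "y * 1 \<le> y * exp dA" using A \<open>1 \<le> y\<close> by (intro mult_left_mono) auto
    then have "y \<le> Y" using \<open>y * exp dA \<le> Y\<close> by simp
    then have "\<sigma> \<le> Y" "0 \<le> \<sigma>" using \<sigma> \<open>1 \<le> y\<close> by auto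
    have K_lip: "\<bar>mean S' \<delta> \<sigma> r - K\<bar> \<le> L * (H r - H s)" if "r \<in> {s..t}" for r
      unfolding L_def K_def
      by (rule mean_increment[OF has_deriv2 M(2) M(1)]) (use that st \<delta> deriv2_eq_0 \<open>\<sigma> \<le> Y\<close> \<open>0 \<le> \<sigma>\<close> in auto)
    have K_le: "\<bar>mean S' \<delta> \<sigma> r - K\<bar> \<le> L * dH" if "r \<in> {s..t}" for r
    proof -
      have "H r \<le> H t" using that st by (intro mono_onD[OF H_mono]) auto
      then have "L * (H r - H s) \<le> L * dH" using nonneg by (intro mult_left_mono) (auto simp: dH_def)
      then show ?thesis using K_lip[OF that] by simp
    qed
    \<comment> \<open>Time advances at the fixed radius \<sigma>, then the radius grows at the fixed
      time t. The means of \<open>S'\<close> at intermediate times and at t are both compared with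
      \<open>K\<close>, their value at time s, at the cost of \<open>L * dH\<close>.\<close>
    have "mean S \<delta> \<sigma> t - mean S \<delta> \<sigma> s \<le> x * (K + L * dH)"
      unfolding x_def dA_def
    proof (rule mean_growth[OF \<delta> \<open>0 \<le> \<sigma>\<close> st])
      show "mean S' \<delta> \<sigma> r \<le> K + L * dH" if "r \<in> {s..t}" for r
        using K_le[OF that] by linarith
    qed
    moreover have "mean S \<delta> (flow \<rho> t) t \<le> mean S \<delta> \<sigma> t - z * mean S' \<delta> \<sigma> t + M * z\<^sup>2"
      by (rule mean_larger_radius_le[OF M(1) _ \<delta> z_def \<open>0 \<le> z\<close>]) (use st in auto)
    moreover have "z * (K - L * dH) \<le> z * mean S' \<delta> \<sigma> t"
      using K_le[of t] st \<open>0 \<le> z\<close> by (intro mult_left_mono) auto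
    moreover have "x * K \<le> z * K"
      using xz mean_deriv_nonneg by (intro mult_right_mono) (auto simp: K_def)
    moreover have "x * (L * dH) \<le> (W * dH) * (L * dH)" "z * (L * dH) \<le> (W * dH) * (L * dH)"
      using xz zW nonneg A by (auto intro!: mult_right_mono)
    moreover have "M * z\<^sup>2 \<le> M * (W * dH)\<^sup>2"
      using zW \<open>0 \<le> z\<close> \<open>0 \<le> M\<close> by (intro mult_left_mono power_mono)
    ultimately have "mean S \<delta> (flow \<rho> t) t - mean S \<delta> \<sigma> s
        \<le> 2 * ((W * dH) * (L * dH)) + M * (W * dH)\<^sup>2"
      by (simp add: algebra_simps)
    then show "mean S \<delta> (flow \<rho> t) t - mean S \<delta> (flow \<rho> s) s \<le> (2 * W * L + M * W\<^sup>2) * (H t - H s)\<^sup>2"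
      by (simp add: \<sigma>_def dH_def algebra_simps power2_eq_square)
  qed
qed

text \<open>The constant in the quadratic bound may depend on \<delta> and \<rho>, since the
  partition is refined with both fixed; \<delta> tends to 0 only afterwards.\<close>

lemma mean_along_flow_decreasing:
  assumes "0 < \<delta>" "0 \<le> \<rho>" "a \<le> t" "t \<le> b"
  shows "mean S \<delta> (flow \<rho> t) t \<le> mean S \<delta> \<rho> a"
proof -
  obtain C where C: "\<And>s t. \<lbrakk>a \<le> s; s \<le> t; t \<le> b\<rbrakk> \<Longrightarrow>
    mean S \<delta> (flow \<rho> t) t - mean S \<delta> (flow \<rho> s) s \<le> C * (H t - H s)\<^sup>2"
    using mean_along_flow_increment[OF assms(1,2)] by blast
  have "mean S \<delta> (flow \<rho> t) t \<le> mean S \<delta> (flow \<rho> a) a"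
  proof (rule le_if_increments_quadratic[where f = "\<lambda>t. mean S \<delta> (flow \<rho> t) t", OF assms(3)])
    show "continuous_on {a..t} H" using H_cont by (rule continuous_on_subset) (use assms in auto)
    show "mono_on {a..t} H" using H_mono by (rule mono_on_subset) (use assms in auto)
    fix q r assume "a \<le> q" "q \<le> r" "r \<le> t"
    then show "mean S \<delta> (flow \<rho> r) r - mean S \<delta> (flow \<rho> q) q \<le> C * (H r - H q)\<^sup>2"
      using C[of q r] assms by simp
  qed
  then show ?thesis by (simp add: flow_def A_start)
qed

text \<open>The smooth step lies above the indicator of {flow \<rho> t \<le> |x|} at time t and
  below that of the slightly larger set \<open>X n\<close> at time a. The sets \<open>X n\<close>
  decrease to {\<rho> \<le> |x|}, so continuity from above removes the width.\<close>

lemma measure_flow_le: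
  assumes "0 \<le> \<rho>" "a \<le> t" "t \<le> b"
  shows "measure (\<mu> t) {x. flow \<rho> t \<le> norm x} \<le> measure (\<mu> a) {x. \<rho> \<le> norm x}"
proof -
  have ab: "t \<in> {a..b}" "a \<in> {a..b}" using assms by auto
  interpret t: prob_space "\<mu> t" by (rule prob[OF ab(1)])
  interpret a: prob_space "\<mu> a" by (rule prob[OF ab(2)])
  have space: "space (\<mu> t) = UNIV" "space (\<mu> a) = UNIV"
    using sets_eq_imp_space_eq[OF sets_borel] ab by auto
  note [measurable_cong] = sets_borel[OF ab(1)] sets_borel[OF ab(2)]
  have "0 \<le> A t" using A_mono[of a t] A_start assms by simp
  then have "1 * 1 \<le> exp (A t) * (1 + \<rho>)" using assms by (intro mult_mono) auto
  then have flow_nonneg: "0 \<le> flow \<rho> t" by (simp add: flow_def)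
  define \<delta> where "\<delta> n = inverse (real (Suc n))" for n
  define X where "X n = {x::'a. \<rho>\<^sup>2 - \<delta> n \<le> x \<bullet> x}" for n
  have "measure (\<mu> t) {x. flow \<rho> t \<le> norm x} \<le> measure (\<mu> a) (X n)" for n
  proof -
    have "0 < \<delta> n" by (simp add: \<delta>_def)
    have "measure (\<mu> t) {x. flow \<rho> t \<le> norm x} = (\<integral>x. indicator {x. flow \<rho> t \<le> norm x} x \<partial>\<mu> t)"
      by (simp add: space)
    also have "\<dots> \<le> mean S (\<delta> n) (flow \<rho> t) t"
      unfolding mean_def
    proof (rule integral_mono)
      show "integrable (\<mu> t) (indicat_real {x. flow \<rho> t \<le> norm x})"
        by (intro t.integrable_const_bound[where B = 1]) (auto simp: indicator_def)
      show "indicat_real {x. flow \<rho> t \<le> norm x} x \<le> radial S (\<delta> n) (flow \<rho> t) x" for x :: 'a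
      proof (cases "flow \<rho> t \<le> norm x")
        case True
        then have "(flow \<rho> t)\<^sup>2 \<le> x \<bullet> x"
          using power_mono[OF True flow_nonneg, of 2] by (simp add: power2_norm_eq_inner)
        then show ?thesis using \<open>0 < \<delta> n\<close> by (simp add: radial_def one indicator_def)
      qed (simp add: radial_def bounds)
    qed (use integrable_radial[OF ab(1)] in auto)
    also have "\<dots> \<le> mean S (\<delta> n) \<rho> a"
      by (rule mean_along_flow_decreasing) (use assms \<open>0 < \<delta> n\<close> in auto)
    also have "\<dots> \<le> (\<integral>x. indicator (X n) x \<partial>\<mu> a)"
      unfolding mean_def
    proof (rule integral_mono)
      show "integrable (\<mu> a) (indicat_real (X n))"
        unfolding X_def by (intro a.integrable_const_bound[where B = 1]) (auto simp: indicator_def)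
      show "radial S (\<delta> n) \<rho> x \<le> indicat_real (X n) x" for x :: 'a
      proof (cases "x \<in> X n")
        case False
        then have "(x \<bullet> x - \<rho>\<^sup>2) / \<delta> n + 1 \<le> 0" using \<open>0 < \<delta> n\<close> by (simp add: X_def field_simps)
        then show ?thesis by (simp add: radial_def zero)
      qed (simp add: radial_def bounds)
    qed (use integrable_radial[OF ab(2)] in auto)
    also have "\<dots> = measure (\<mu> a) (X n)" by (simp add: space)
    finally show ?thesis .
  qed
  moreover have "(\<lambda>n. measure (\<mu> a) (X n)) \<longlonglongrightarrow> measure (\<mu> a) (\<Inter>n. X n)"
  proof (rule a.finite_Lim_measure_decseq)
    show "range X \<subseteq> sets (\<mu> a)" unfolding X_def by auto
    have "\<delta> j \<le> \<delta> i" if "i \<le> j" for i j using that by (simp add: \<delta>_def field_simps)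
    then show "decseq X" by (force simp: decseq_def X_def)
  qed
  ultimately have "measure (\<mu> t) {x. flow \<rho> t \<le> norm x} \<le> measure (\<mu> a) (\<Inter>n. X n)"
    by (intro LIMSEQ_le_const) auto
  also have "(\<Inter>n. X n) = {x. \<rho> \<le> norm x}"
  proof (intro set_eqI iffI)
    fix x assume "x \<in> (\<Inter>n. X n)"
    then have "\<rho>\<^sup>2 - \<delta> n \<le> x \<bullet> x" for n by (auto simp: X_def)
    moreover have "(\<lambda>n. \<rho>\<^sup>2 - \<delta> n) \<longlonglongrightarrow> \<rho>\<^sup>2 - 0"
      unfolding \<delta>_def by (intro tendsto_intros LIMSEQ_inverse_real_of_nat)
    ultimately have "\<rho>\<^sup>2 \<le> x \<bullet> x" by (intro LIMSEQ_le_const2) auto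
    then have "\<rho>\<^sup>2 \<le> (norm x)\<^sup>2" by (simp add: power2_norm_eq_inner)
    then show "x \<in> {x. \<rho> \<le> norm x}" using power2_le_imp_le[of \<rho> "norm x"] by simp
  next
    fix x :: 'a assume "x \<in> {x. \<rho> \<le> norm x}"
    then have "\<rho>\<^sup>2 \<le> x \<bullet> x" using power_mono[of \<rho> "norm x" 2] assms by (simp add: power2_norm_eq_inner)
    moreover have "0 \<le> \<delta> n" for n by (simp add: \<delta>_def)
    ultimately show "x \<in> (\<Inter>n. X n)" by (auto simp: X_def intro: order_trans[rotated])
  qed
  finally show ?thesis .
qed

section \<open>Stochastic domination and the moment estimates\<close>

lemma norm_stochastically_dominated:
  assumes h: "mono h" and t: "a \<le> t" "t \<le> b"
  shows "(\<integral>\<^sup>+x. ennreal (h (norm x)) \<partial>\<mu> t) \<le> (\<integral>\<^sup>+x. ennreal (h (exp (A t) * (1 + norm x) - 1)) \<partial>\<mu> a)"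
proof (rule nn_integral_mono_stochastic_order[OF _ _ _ _ _ h])
  have ab: "t \<in> {a..b}" "a \<in> {a..b}" using t by auto
  show "prob_space (\<mu> t)" "prob_space (\<mu> a)" using prob ab by auto
  interpret t: prob_space "\<mu> t" by (rule prob[OF ab(1)])
  interpret a: prob_space "\<mu> a" by (rule prob[OF ab(2)])
  have space: "space (\<mu> t) = UNIV" "space (\<mu> a) = UNIV"
    using sets_eq_imp_space_eq[OF sets_borel] ab by auto
  note [measurable_cong] = sets_borel[OF ab(1)] sets_borel[OF ab(2)]
  show "norm \<in> borel_measurable (\<mu> t)" "(\<lambda>x. exp (A t) * (1 + norm x) - 1) \<in> borel_measurable (\<mu> a)"
    by measurable
  fix q
  show "emeasure (\<mu> t) {x \<in> space (\<mu> t). q \<le> norm x}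
    \<le> emeasure (\<mu> a) {x \<in> space (\<mu> a). q \<le> exp (A t) * (1 + norm x) - 1}"
  \<comment> \<open>The value \<open>exp (A t) - 1\<close> is the image of radius 0. Levels q above
    it are reached by the flow from a radius \<rho> \<ge> 0; below it the event on the right is the
    whole space.\<close>
  proof (cases "exp (A t) - 1 \<le> q")
    case True
    define \<rho> where "\<rho> = (q + 1) / exp (A t) - 1"
    have "0 \<le> \<rho>" using True by (simp add: \<rho>_def field_simps)
    from measure_flow_le[OF this t] have "measure (\<mu> t) {x. q \<le> norm x} \<le> measure (\<mu> a) {x. \<rho> \<le> norm x}"
      by (simp add: flow_def \<rho>_def)
    moreover have "{x::'a. \<rho> \<le> norm x} = {x. q \<le> exp (A t) * (1 + norm x) - 1}"
      by (auto simp: \<rho>_def field_simps)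
    ultimately show ?thesis
      by (simp add: space t.emeasure_eq_measure a.emeasure_eq_measure)
  next
    case False
    have "q \<le> exp (A t) * (1 + norm x) - 1" for x :: 'a
    proof -
      have "exp (A t) * 1 \<le> exp (A t) * (1 + norm x)" by (intro mult_left_mono) auto
      then show ?thesis using False by linarith
    qed
    then have "{x \<in> space (\<mu> a). q \<le> exp (A t) * (1 + norm x) - 1} = space (\<mu> a)" by auto
    then show ?thesis by (simp add: a.emeasure_space_1 t.emeasure_le_1)
  qed
qed

lemma truncated_moment_le:
  assumes p: "0 \<le> p" and R: "0 \<le> R" and t: "a \<le> t" "t \<le> b"
  shows "(\<integral>\<^sup>+x\<in>{x. R \<le> norm x}. ennreal (norm x powr p) \<partial>\<mu> t)
    \<le> (\<integral>\<^sup>+x\<in>{x. R \<le> exp (A t) * (1 + norm x) - 1}. ennreal ((exp (A t) * (1 + norm x) - 1) powr p) \<partial>\<mu> a)"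
proof -
  \<comment> \<open>The truncated power jumps at \<open>R\<close> but is monotone on the whole line;
    0 \<le> R keeps negative bases out of \<open>powr\<close>.\<close>
  define h where "h y = (if R \<le> y then y powr p else 0)" for y :: real
  have "mono h"
  proof
    fix y z :: real assume "y \<le> z"
    then show "h y \<le> h z" using p R by (auto simp: h_def intro: powr_mono2)
  qed
  have "(\<integral>\<^sup>+x\<in>{x. R \<le> norm x}. ennreal (norm x powr p) \<partial>\<mu> t) = (\<integral>\<^sup>+x. ennreal (h (norm x)) \<partial>\<mu> t)"
    by (intro nn_integral_cong) (auto simp: h_def indicator_def)
  also have "\<dots> \<le> (\<integral>\<^sup>+x. ennreal (h (exp (A t) * (1 + norm x) - 1)) \<partial>\<mu> a)"
    by (rule norm_stochastically_dominated[OF \<open>mono h\<close> t])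
  also have "\<dots> = (\<integral>\<^sup>+x\<in>{x. R \<le> exp (A t) * (1 + norm x) - 1}. ennreal ((exp (A t) * (1 + norm x) - 1) powr p) \<partial>\<mu> a)"
    by (intro nn_integral_cong) (auto simp: h_def indicator_def)
  finally show ?thesis .
qed

text \<open>Domination with truncation at 0, then Minkowski with \<alpha> = exp (A t) and \<beta> =
  exp (A t) - 1, and finally exp A - 1 \<le> A exp A.\<close>

lemma moment_le:
  assumes p: "1 \<le> p" and t: "a \<le> t" "t \<le> b" and \<mu>: "\<mu> t \<in> prob_measures p" "\<mu> a \<in> prob_measures p"
  shows "moment p (\<mu> t) \<le> exp (A t) * (moment p (\<mu> a) + A t)"
proof -
  have "0 \<le> A t" using A_mono[of a t] A_start t by simp
  interpret prob_space "\<mu> a" using \<mu> by (simp add: prob_measures_def)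
  have [measurable_cong]: "sets (\<mu> a) = sets borel" using \<mu> by (simp add: prob_measures_def)
  define N where "N = exp (A t) * moment p (\<mu> a) + (exp (A t) - 1)"
  have "ennreal (\<integral>x. norm x powr p \<partial>\<mu> t) = (\<integral>\<^sup>+x. ennreal (norm x powr p) \<partial>\<mu> t)"
    using \<mu> by (subst nn_integral_eq_integral) (auto simp: prob_measures_def)
  also have "\<dots> \<le> (\<integral>\<^sup>+x\<in>{x. 0 \<le> exp (A t) * (1 + norm x) - 1}. ennreal ((exp (A t) * (1 + norm x) - 1) powr p) \<partial>\<mu> a)"
    using truncated_moment_le[of p 0 t] p t by simp
  also have "\<dots> \<le> (\<integral>\<^sup>+x. ennreal ((exp (A t) * norm x + (exp (A t) - 1)) powr p) \<partial>\<mu> a)"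
    by (intro nn_integral_mono) (auto simp: indicator_def algebra_simps)
  also have "\<dots> \<le> ennreal (N powr p)"
    unfolding N_def moment_def using \<mu> p \<open>0 \<le> A t\<close>
    by (intro minkowski_const) (auto simp: prob_measures_def)
  finally have "(\<integral>x. norm x powr p \<partial>\<mu> t) \<le> N powr p" by simp
  then have "moment p (\<mu> t) \<le> (N powr p) powr (1 / p)"
    unfolding moment_def using p by (intro powr_mono2 integral_nonneg_AE) auto
  also have "\<dots> = N"
    using p \<open>0 \<le> A t\<close> by (simp add: powr_powr N_def moment_def)
  also have "exp (A t) - 1 \<le> exp (A t) * A t"
  proof -
    have "exp (A t) * (1 - A t) \<le> exp (A t) * exp (- A t)"
      using exp_ge_add_one_self[of "- A t"] by (intro mult_left_mono) auto
    then show ?thesis by (simp add: exp_minus algebra_simps)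
  qed
  then have "N \<le> exp (A t) * (moment p (\<mu> a) + A t)"
    by (simp add: N_def algebra_simps)
  finally show ?thesis .
qed

text \<open>Since exp (A t) (1 + |x|) - 1 \<le> C (1 + |x|), both the integrand and the domain grow
  when the left side is replaced by the right; R \<le> C (1 + |x|) is the condition R / C - 1 \<le>
  |x|.\<close>

lemma tail_moment_le:
  assumes p: "0 \<le> p" and R: "0 < R" and t: "a \<le> t" "t \<le> b" and C: "exp (A t) \<le> C"
  shows "(\<integral>\<^sup>+x\<in>{x. R \<le> norm x}. ennreal (norm x powr p) \<partial>\<mu> t)
    \<le> ennreal (C powr p) * (\<integral>\<^sup>+x\<in>{x. R / C - 1 \<le> norm x}. ennreal ((1 + norm x) powr p) \<partial>\<mu> a)"
proof -
  have [measurable_cong]: "sets (\<mu> a) = sets borel" using sets_borel t by simp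
  have "0 < C" using C exp_gt_zero[of "A t"] by linarith
  have le: "exp (A t) * (1 + norm x) - 1 \<le> C * (1 + norm x)" for x :: 'a
  proof -
    have "exp (A t) * (1 + norm x) \<le> C * (1 + norm x)" using C by (intro mult_right_mono) auto
    then show ?thesis by simp
  qed
  have "(\<integral>\<^sup>+x\<in>{x. R \<le> norm x}. ennreal (norm x powr p) \<partial>\<mu> t)
      \<le> (\<integral>\<^sup>+x\<in>{x. R \<le> exp (A t) * (1 + norm x) - 1}. ennreal ((exp (A t) * (1 + norm x) - 1) powr p) \<partial>\<mu> a)"
    using truncated_moment_le[OF p _ t] R by simp
  also have "\<dots> \<le> (\<integral>\<^sup>+x. ennreal (C powr p) * (ennreal ((1 + norm x) powr p) * indicator {x. R / C - 1 \<le> norm x} x) \<partial>\<mu> a)"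
  proof (rule nn_integral_mono)
    fix x :: 'a
    show "ennreal ((exp (A t) * (1 + norm x) - 1) powr p) * indicator {x. R \<le> exp (A t) * (1 + norm x) - 1} x
        \<le> ennreal (C powr p) * (ennreal ((1 + norm x) powr p) * indicator {x. R / C - 1 \<le> norm x} x)"
    proof (cases "R \<le> exp (A t) * (1 + norm x) - 1")
      case True
      then have "R \<le> C * (1 + norm x)" using le[of x] by linarith
      then have "R / C - 1 \<le> norm x" using \<open>0 < C\<close> by (simp add: field_simps)
      moreover have "(exp (A t) * (1 + norm x) - 1) powr p \<le> (C * (1 + norm x)) powr p"
        using True R le[of x] p by (intro powr_mono2) auto
      ultimately show ?thesis
        using True \<open>0 < C\<close> by (simp add: powr_mult ennreal_mult[symmetric])
    qed simp
  qed
  also have "\<dots> = ennreal (C powr p) * (\<integral>\<^sup>+x\<in>{x. R / C - 1 \<le> norm x}. ennreal ((1 + norm x) powr p) \<partial>\<mu> a)"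
    by (intro nn_integral_cmult) measurable
  finally show ?thesis .
qed

end

section \<open>From absolute continuity in the Wasserstein distance to the two estimates\<close>

lemma transported_curve_if_wasserstein_AC:
  fixes \<mu> :: "real \<Rightarrow> 'a::euclidean_space measure"
  assumes S: "smooth_step S" and p: "1 \<le> p" and "a \<le> b"
    and AC: "wasserstein_AC p a b \<mu>" and eq: "continuity_equation a b v \<mu>"
    and v: "(\<lambda>(t, x). v t x) \<in> borel_measurable (lebesgue_on {a..b} \<Otimes>\<^sub>M borel)"
    and m: "set_integrable lebesgue {a..b} m" "\<And>t. t \<in> {a..b} \<Longrightarrow> 0 \<le> m t"
    and bound: "AE t in lebesgue_on {a..b}. AE x in \<mu> t. norm (v t x) \<le> m t * (1 + norm x)"
  obtains H where "transported_curve S a b \<mu> v m H"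
proof -
  obtain g where g: "set_integrable lebesgue {a..b} g" "\<And>t. t \<in> {a..b} \<Longrightarrow> 0 \<le> g t"
    and W: "\<And>s t. \<lbrakk>s \<in> {a..b}; t \<in> {s..b}\<rbrakk> \<Longrightarrow> wasserstein p (\<mu> s) (\<mu> t) \<le> (LINT r:{s..t}|lebesgue. g r)"
    using AC unfolding wasserstein_AC_def by blast
  have P: "\<And>t. t \<in> {a..b} \<Longrightarrow> \<mu> t \<in> prob_measures p"
    using AC by (simp add: wasserstein_AC_def)
  \<comment> \<open>The primitive of g + m dominates the displacement in the Wasserstein distance
    and the increments of the integral of m simultaneously.\<close>
  define f where "f r = g r + m r" for r
  have f: "set_integrable lebesgue {a..b} f"
    unfolding f_def[abs_def] using g m by (intro set_integral_add)
  define H where "H t = (LINT r:{a..t}|lebesgue. f r)" for t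
  have nonneg: "0 \<le> (LINT r:{s..t}|lebesgue. k r)" if "a \<le> s" "t \<le> b" "\<And>r. r \<in> {a..b} \<Longrightarrow> 0 \<le> k r"
    for s t and k :: "real \<Rightarrow> real"
    unfolding set_lebesgue_integral_def
    using that by (intro integral_nonneg_AE AE_I2) (auto simp: indicator_def)
  have H_diff: "H t - H s = (LINT r:{s..t}|lebesgue. g r) + (LINT r:{s..t}|lebesgue. m r)"
    if "a \<le> s" "s \<le> t" "t \<le> b" for s t
  proof -
    have "set_integrable lebesgue {s..t} g" "set_integrable lebesgue {s..t} m"
      using that by (auto intro: set_integrable_subset[OF g(1)] set_integrable_subset[OF m(1)])
    then have "(LINT r:{s..t}|lebesgue. f r) = (LINT r:{s..t}|lebesgue. g r) + (LINT r:{s..t}|lebesgue. m r)"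
      unfolding f_def[abs_def] by (rule set_integral_add)
    then show ?thesis
      using set_integral_diff_interval[OF f that] by (simp add: H_def)
  qed
  have "transported_curve S a b \<mu> v m H"
  proof (intro transported_curve.intro transported_curve_axioms.intro S)
    fix L B s t :: real and \<psi> :: "'a \<Rightarrow> real"
    assume lip: "L-lipschitz_on UNIV \<psi>" and bd: "\<And>x. \<bar>\<psi> x\<bar> \<le> B" and st: "a \<le> s" "s \<le> t" "t \<le> b"
    have "\<bar>(\<integral>x. \<psi> x \<partial>\<mu> t) - (\<integral>x. \<psi> x \<partial>\<mu> s)\<bar> \<le> L * wasserstein p (\<mu> s) (\<mu> t)"
      using lipschitz_integral_diff_le_wasserstein[OF p P P lip bd, of s t] st by (simp add: abs_minus_commute)
    also have "\<dots> \<le> L * (H t - H s)"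
      using W[of s t] H_diff[OF st] nonneg[of s t m] m st lipschitz_on_nonneg[OF lip]
      by (intro mult_left_mono) auto
    finally show "\<bar>(\<integral>x. \<psi> x \<partial>\<mu> t) - (\<integral>x. \<psi> x \<partial>\<mu> s)\<bar> \<le> L * (H t - H s)" .
  next
    show "continuous_on {a..b} H"
      unfolding H_def[abs_def] by (rule continuous_on_set_integral[OF f])
    show "mono_on {a..b} H"
    proof (rule mono_onI)
      fix s t assume "s \<in> {a..b}" "t \<in> {a..b}" "s \<le> t"
      then show "H s \<le> H t" using H_diff[of s t] nonneg[of s t g] nonneg[of s t m] g m by simp
    qed
    fix s t assume "a \<le> s" "s \<le> t" "t \<le> b"
    then show "(LINT r:{s..t}|lebesgue. m r) \<le> H t - H s"
      using H_diff[of s t] nonneg[of s t g] g by simp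
  qed (use P assms in \<open>auto simp: prob_measures_def\<close>)
  then show thesis by (rule that)
qed

theorem proposition2p21:
  fixes p T \<tau> :: real
    and \<mu>\<tau> :: "'a::euclidean_space measure"
    and \<mu> :: "real \<Rightarrow> 'a measure"
    and v :: "real \<Rightarrow> 'a \<Rightarrow> 'a"
    and m :: "real \<Rightarrow> real"
  assumes "1 \<le> p" and "0 < T" and "\<tau> \<in> {0..T}" and "\<mu>\<tau> \<in> prob_measures p"
    and "wasserstein_AC p \<tau> T \<mu>"
    and "continuity_equation \<tau> T v \<mu>" and "\<mu> \<tau> = \<mu>\<tau>"
    and "(\<lambda>(t, x). v t x) \<in> borel_measurable (lebesgue_on {0..T} \<Otimes>\<^sub>M borel)"
    and "set_integrable lebesgue {0..T} m" and "\<forall>t\<in>{0..T}. 0 \<le> m t"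
    and "AE t in lebesgue_on {\<tau>..T}. AE x in \<mu> t. norm (v t x) \<le> m t * (1 + norm x)"
  defines "C \<equiv> 2 powr ((p - 1) / p)"
    and "C' \<equiv> 2 powr (p - 1) / p"
    and "C\<^sub>T \<equiv> max 1 (L1_norm 0 T m) * exp (L1_norm 0 T m)"
  shows "(\<forall>t\<in>{\<tau>..T}. moment p (\<mu> t)
            \<le> C * (moment p \<mu>\<tau> + (LINT s:{\<tau>..t}|lebesgue. m s)) * exp (C' * L1_norm \<tau> t m powr p))
       \<and> (\<forall>R>0. (SUP t\<in>{\<tau>..T}. \<integral>\<^sup>+x\<in>{x. R \<le> norm x}. ennreal (norm x powr p) \<partial>\<mu> t)
            \<le> ennreal (C\<^sub>T powr p) *
               (\<integral>\<^sup>+x\<in>{x. R / C\<^sub>T - 1 \<le> norm x}. ennreal ((1 + norm x) powr p) \<partial>\<mu>\<tau>))"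
proof -
  have \<tau>: "0 \<le> \<tau>" "\<tau> \<le> T" using assms(3) by auto
  obtain S where S: "smooth_step S"
  proof -
    obtain S :: "real \<Rightarrow> real" where "smooth S" "\<And>x. x \<le> 0 \<Longrightarrow> S x = 0" "\<And>x. 1 \<le> x \<Longrightarrow> S x = 1"
      "\<And>x. 0 \<le> deriv S x" using exists_smooth_step by blast
    then have "smooth_step S" by unfold_locales
    then show thesis by (rule that)
  qed
  have "(\<lambda>z. z) \<in> measurable (lebesgue_on {\<tau>..T}) (lebesgue_on {0..T})"
    using \<tau> by (intro measurable_restrict_space3 measurable_ident) auto
  then have "(\<lambda>z. (fst z, snd z)) \<in> measurable (lebesgue_on {\<tau>..T} \<Otimes>\<^sub>M (borel :: 'a measure)) (lebesgue_on {0..T} \<Otimes>\<^sub>M borel)"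
    by (intro measurable_Pair measurable_compose[OF measurable_fst] measurable_snd)
  from measurable_compose[OF this assms(8)]
  have v: "(\<lambda>(t, x). v t x) \<in> borel_measurable (lebesgue_on {\<tau>..T} \<Otimes>\<^sub>M borel)"
    by (simp add: case_prod_beta')
  have m: "set_integrable lebesgue {\<tau>..T} m"
    using assms(9) by (rule set_integrable_subset) (use \<tau> in auto)
  obtain H where "transported_curve S \<tau> T \<mu> v m H"
    using transported_curve_if_wasserstein_AC[OF S assms(1) \<tau>(2) assms(5,6) v m _ assms(11)] assms(10) \<tau>
    by (metis atLeastAtMost_iff order_trans)
  then interpret transported_curve S \<tau> T \<mu> v m H .
  have L1: "L1_norm \<tau> t m = A t" if "t \<in> {\<tau>..T}" for t
    unfolding L1_norm_def A_def set_lebesgue_integral_def using that m_nonneg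
    by (intro Bochner_Integration.integral_cong) (auto simp: indicator_def)
  \<comment> \<open>Since m is nonnegative, enlarging the interval from [\<tau>, t] to [0, T] can
    only increase its integral.\<close>
  have A_le: "A t \<le> L1_norm 0 T m" and A_nonneg: "0 \<le> A t" if t: "t \<in> {\<tau>..T}" for t
  proof -
    show "0 \<le> A t" using A_mono[of \<tau> t] A_start t by simp
    have "set_integrable lebesgue {\<tau>..t} m"
      using m by (rule set_integrable_subset) (use t in auto)
    then show "A t \<le> L1_norm 0 T m"
      unfolding A_def L1_norm_def set_lebesgue_integral_def
      using assms(9) set_integrable_abs[OF assms(9)] t \<tau>
      by (intro integral_mono) (auto simp: set_integrable_def indicator_def)
  qed
  have P: "\<mu> t \<in> prob_measures p" if "t \<in> {\<tau>..T}" for t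
    using assms(5) that by (simp add: wasserstein_AC_def)
  show ?thesis
  proof (intro conjI ballI allI impI)
    fix t assume t: "t \<in> {\<tau>..T}"
    have "moment p (\<mu> t) \<le> exp (A t) * (moment p \<mu>\<tau> + A t)"
      using moment_le[OF assms(1), of t] P t \<tau> assms(4,7) by simp
    also have "\<dots> \<le> (C * exp (C' * A t powr p)) * (moment p \<mu>\<tau> + A t)"
      unfolding C_def C'_def
      using exp_le_const_exp_powr[OF assms(1) A_nonneg[OF t]] A_nonneg[OF t]
      by (intro mult_right_mono) (auto simp: moment_def)
    finally show "moment p (\<mu> t)
        \<le> C * (moment p \<mu>\<tau> + (LINT s:{\<tau>..t}|lebesgue. m s)) * exp (C' * L1_norm \<tau> t m powr p)"
      using L1[OF t] by (simp add: A_def mult_ac)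
  next
    fix R :: real assume R: "0 < R"
    show "(SUP t\<in>{\<tau>..T}. \<integral>\<^sup>+x\<in>{x. R \<le> norm x}. ennreal (norm x powr p) \<partial>\<mu> t)
        \<le> ennreal (C\<^sub>T powr p) * (\<integral>\<^sup>+x\<in>{x. R / C\<^sub>T - 1 \<le> norm x}. ennreal ((1 + norm x) powr p) \<partial>\<mu>\<tau>)"
    proof (rule SUP_least)
      fix t assume t: "t \<in> {\<tau>..T}"
      \<comment> \<open>The first factor of \<open>C\<^sub>T\<close> is at least 1 and its exponent
        is at least \<open>A t\<close>, so \<open>C\<^sub>T\<close> is an admissible constant at
        every time t.\<close>
      have "1 * exp (A t) \<le> C\<^sub>T"
        unfolding C\<^sub>T_def using A_le[OF t] by (intro mult_mono) auto
      then show "(\<integral>\<^sup>+x\<in>{x. R \<le> norm x}. ennreal (norm x powr p) \<partial>\<mu> t)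
          \<le> ennreal (C\<^sub>T powr p) * (\<integral>\<^sup>+x\<in>{x. R / C\<^sub>T - 1 \<le> norm x}. ennreal ((1 + norm x) powr p) \<partial>\<mu>\<tau>)"
        using tail_moment_le[of p R t C\<^sub>T] R t assms(1,7) by simp
    qed
  qed
qed

end
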